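(* Let $k\ge 0$ be an integer. Define the linear operators on symmetric functions $$CH_{1^k} = \sum_{\lambda} (-1)^{|\lambda|} e_{\lambda+1^k}\, m_\lambda^{\perp},\qquad CE_{1^k} = \sum_{\lambda} (-1)^{|\lambda|} h_{\lambda+1^k}\, f_\lambda^{\perp},$$ where the sums range over all partitions $\lambda$, with the convention $e_{\lambda+1^k}=h_{\lambda+1^k}=0$ when $l(\lambda)>k$. Then for every partition $\lambda$ with $l(\lambda)\le k$, $CH_{1^k} h_\lambda = h_{\lambda+1^k}$ and $CE_{1^k} e_\lambda = e_{\lambda+1^k}$.
   Context: $\Lambda$ is the ring of symmetric functions over $\mathbb{Q}$ with the Hall inner product, for which the monomial basis $\{m_\lambda\}$ and the homogeneous basis $\{h_\lambda\}$ are dual, and the forgotten basis $\{f_\lambda\}$ (defined by $f_\lambda=\omega(m_\lambda)$, where $\omega$ is the involution with $\omega(h_\lambda)=e_\lambda$) is dual to the elementary basis $\{e_\lambda\}$. For a symmetric function $g$, $g^\perp$ is the adjoint of multiplication by $g$ with respect to the Hall inner product. $|\lambda|$ is the size and $l(\lambda)$ the number of nonzero parts of $\lambda$. For $l(\lambda)\le k$, $\lambda+1^k$ denotes the partition $(\lambda_1+1,\ldots,\lambda_k+1)$ with $\lambda_i=0$ for $i>l(\lambda)$; thus $e_{\lambda+1^k}=\prod_{i=1}^k e_{\lambda_i+1}$ and $h_{\lambda+1^k}=\prod_{i=1}^k h_{\lambda_i+1}$. *)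

theory Defs
  imports Complex_Main "HOL-Library.Multiset" "HOL-Library.Groups_Big_Fun"
begin

section \<open>The ring of symmetric functions over the rationals\<close>

text \<open>
  A monomial in the variables \<open>x\<^sub>0, x\<^sub>1, \<dots>\<close> is encoded as the finite multiset of its variables,
  so the product of monomials is multiset sum and the degree is the size.  A symmetric
  function is a formal series in such monomials (given by its coefficient function) of bounded
  degree and invariant under permuting the variables.
\<close>

typedef symfun =
  "{f :: nat multiset \<Rightarrow> rat.
      (\<exists>d. \<forall>\<alpha>. d < size \<alpha> \<longrightarrow> f \<alpha> = 0) \<and>
      (\<forall>\<pi> \<alpha>. bij \<pi> \<longrightarrow> f (image_mset \<pi> \<alpha>) = f \<alpha>)}"
  morphisms coeff_symfun Abs_symfun
  by (rule exI[of _ "\<lambda>_. 0"]) simp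

setup_lifting type_definition_symfun

lemma finite_submultisets: "finite {\<alpha>. \<alpha> \<subseteq># (\<gamma> :: 'a multiset)}"
proof (induction \<gamma>)
  case empty
  then show ?case by simp
next
  case (add x \<gamma>)
  have "{\<alpha>. \<alpha> \<subseteq># add_mset x \<gamma>} \<subseteq> {\<alpha>. \<alpha> \<subseteq># \<gamma>} \<union> add_mset x ` {\<alpha>. \<alpha> \<subseteq># \<gamma>}"
  proof
    fix \<alpha> assume "\<alpha> \<in> {\<alpha>. \<alpha> \<subseteq># add_mset x \<gamma>}"
    then have sub: "\<alpha> \<subseteq># add_mset x \<gamma>" by simp
    show "\<alpha> \<in> {\<alpha>. \<alpha> \<subseteq># \<gamma>} \<union> add_mset x ` {\<alpha>. \<alpha> \<subseteq># \<gamma>}"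
    proof (cases "x \<in># \<alpha>")
      case True
      then obtain \<beta> where "\<alpha> = add_mset x \<beta>" by (metis insert_DiffM)
      with sub show ?thesis by auto
    next
      case False
      with sub have "\<alpha> \<subseteq># \<gamma>"
        by (metis diff_single_trivial add_mset_remove_trivial subset_eq_diff_conv
            add_mset_add_single add.commute)
      then show ?thesis by simp
    qed
  qed
  then show ?case using add.IH by (meson finite_UnI finite_imageI finite_subset)
qed

lemma image_mset_inv_bij:
  fixes \<pi> :: "'a \<Rightarrow> 'a"
  assumes "bij \<pi>"
  shows "image_mset (inv \<pi>) (image_mset \<pi> \<alpha>) = \<alpha>"
    and "image_mset \<pi> (image_mset (inv \<pi>) \<alpha>) = \<alpha>"
  using assms by (simp_all add: multiset.map_comp comp_def bij_is_inj bij_is_surj surj_f_inv_f)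

lemma submultisets_image_mset:
  fixes \<pi> :: "'a \<Rightarrow> 'a"
  assumes "bij \<pi>"
  shows "{\<alpha>. \<alpha> \<subseteq># image_mset \<pi> \<gamma>} = image_mset \<pi> ` {\<alpha>. \<alpha> \<subseteq># \<gamma>}"
proof
  show "{\<alpha>. \<alpha> \<subseteq># image_mset \<pi> \<gamma>} \<subseteq> image_mset \<pi> ` {\<alpha>. \<alpha> \<subseteq># \<gamma>}"
  proof
    fix \<alpha> assume "\<alpha> \<in> {\<alpha>. \<alpha> \<subseteq># image_mset \<pi> \<gamma>}"
    then have "image_mset (inv \<pi>) \<alpha> \<subseteq># \<gamma>"
      using image_mset_subseteq_mono[of \<alpha> "image_mset \<pi> \<gamma>" "inv \<pi>"]
      by (simp only: image_mset_inv_bij(1)[OF assms] mem_Collect_eq)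
    then show "\<alpha> \<in> image_mset \<pi> ` {\<alpha>. \<alpha> \<subseteq># \<gamma>}"
      using image_mset_inv_bij(2)[OF assms, of \<alpha>] by (metis image_eqI mem_Collect_eq)
  qed
qed (auto intro: image_mset_subseteq_mono)

lemma symfun_conv_invariant:
  fixes f g :: "nat multiset \<Rightarrow> rat"
  assumes "bij \<pi>"
    and f: "\<And>\<alpha>. f (image_mset \<pi> \<alpha>) = f \<alpha>"
    and g: "\<And>\<alpha>. g (image_mset \<pi> \<alpha>) = g \<alpha>"
  shows "(\<Sum>\<alpha> | \<alpha> \<subseteq># image_mset \<pi> \<gamma>. f \<alpha> * g (image_mset \<pi> \<gamma> - \<alpha>)) =
         (\<Sum>\<alpha> | \<alpha> \<subseteq># \<gamma>. f \<alpha> * g (\<gamma> - \<alpha>))"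
proof -
  have inj: "inj_on (image_mset \<pi>) {\<alpha>. \<alpha> \<subseteq># \<gamma>}"
    by (rule inj_on_inverseI[of _ "image_mset (inv \<pi>)"]) (rule image_mset_inv_bij(1)[OF assms(1)])
  have "f (image_mset \<pi> \<alpha>) * g (image_mset \<pi> \<gamma> - image_mset \<pi> \<alpha>) = f \<alpha> * g (\<gamma> - \<alpha>)"
    if "\<alpha> \<subseteq># \<gamma>" for \<alpha>
    by (metis f g image_mset_Diff that)
  then show ?thesis
    by (simp add: submultisets_image_mset[OF assms(1)] sum.reindex[OF inj])
qed

lemma symfun_conv_bounded:
  fixes f g :: "nat multiset \<Rightarrow> rat"
  assumes f: "\<And>\<alpha>. d < size \<alpha> \<Longrightarrow> f \<alpha> = 0" and g: "\<And>\<alpha>. d' < size \<alpha> \<Longrightarrow> g \<alpha> = 0"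
    and \<gamma>: "d + d' < size \<gamma>"
  shows "(\<Sum>\<alpha> | \<alpha> \<subseteq># \<gamma>. f \<alpha> * g (\<gamma> - \<alpha>)) = 0"
proof (rule sum.neutral, safe)
  fix \<alpha> assume "\<alpha> \<subseteq># \<gamma>"
  then have "size (\<gamma> - \<alpha>) = size \<gamma> - size \<alpha>" by (rule size_Diff_submset)
  with \<gamma> have "d < size \<alpha> \<or> d' < size (\<gamma> - \<alpha>)" by linarith
  then show "f \<alpha> * g (\<gamma> - \<alpha>) = 0" using f g by auto
qed

instantiation symfun :: comm_ring_1
begin

lift_definition zero_symfun :: symfun is "\<lambda>_. 0"
  by simp

lift_definition one_symfun :: symfun is "\<lambda>\<alpha>. if \<alpha> = {#} then 1 else 0"
  by auto

lift_definition plus_symfun :: "symfun \<Rightarrow> symfun \<Rightarrow> symfun" is "\<lambda>f g \<alpha>. f \<alpha> + g \<alpha>"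
proof -
  fix f g :: "nat multiset \<Rightarrow> rat"
  assume "(\<exists>d. \<forall>\<alpha>. d < size \<alpha> \<longrightarrow> f \<alpha> = 0) \<and> (\<forall>\<pi> \<alpha>. bij \<pi> \<longrightarrow> f (image_mset \<pi> \<alpha>) = f \<alpha>)"
    and "(\<exists>d. \<forall>\<alpha>. d < size \<alpha> \<longrightarrow> g \<alpha> = 0) \<and> (\<forall>\<pi> \<alpha>. bij \<pi> \<longrightarrow> g (image_mset \<pi> \<alpha>) = g \<alpha>)"
  then show "(\<exists>d. \<forall>\<alpha>. d < size \<alpha> \<longrightarrow> f \<alpha> + g \<alpha> = 0) \<and>
      (\<forall>\<pi> \<alpha>. bij \<pi> \<longrightarrow> f (image_mset \<pi> \<alpha>) + g (image_mset \<pi> \<alpha>) = f \<alpha> + g \<alpha>)"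
    by (metis add.right_neutral max_less_iff_conj)
qed

lift_definition uminus_symfun :: "symfun \<Rightarrow> symfun" is "\<lambda>f \<alpha>. - f \<alpha>"
  by simp

lift_definition minus_symfun :: "symfun \<Rightarrow> symfun \<Rightarrow> symfun" is "\<lambda>f g \<alpha>. f \<alpha> - g \<alpha>"
proof -
  fix f g :: "nat multiset \<Rightarrow> rat"
  assume "(\<exists>d. \<forall>\<alpha>. d < size \<alpha> \<longrightarrow> f \<alpha> = 0) \<and> (\<forall>\<pi> \<alpha>. bij \<pi> \<longrightarrow> f (image_mset \<pi> \<alpha>) = f \<alpha>)"
    and "(\<exists>d. \<forall>\<alpha>. d < size \<alpha> \<longrightarrow> g \<alpha> = 0) \<and> (\<forall>\<pi> \<alpha>. bij \<pi> \<longrightarrow> g (image_mset \<pi> \<alpha>) = g \<alpha>)"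
  then show "(\<exists>d. \<forall>\<alpha>. d < size \<alpha> \<longrightarrow> f \<alpha> - g \<alpha> = 0) \<and>
      (\<forall>\<pi> \<alpha>. bij \<pi> \<longrightarrow> f (image_mset \<pi> \<alpha>) - g (image_mset \<pi> \<alpha>) = f \<alpha> - g \<alpha>)"
    by (metis diff_zero max_less_iff_conj)
qed

lift_definition times_symfun :: "symfun \<Rightarrow> symfun \<Rightarrow> symfun"
  is "\<lambda>f g \<gamma>. \<Sum>\<alpha> | \<alpha> \<subseteq># \<gamma>. f \<alpha> * g (\<gamma> - \<alpha>)"
proof -
  fix f g :: "nat multiset \<Rightarrow> rat"
  assume f: "(\<exists>d. \<forall>\<alpha>. d < size \<alpha> \<longrightarrow> f \<alpha> = 0) \<and> (\<forall>\<pi> \<alpha>. bij \<pi> \<longrightarrow> f (image_mset \<pi> \<alpha>) = f \<alpha>)"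
    and g: "(\<exists>d. \<forall>\<alpha>. d < size \<alpha> \<longrightarrow> g \<alpha> = 0) \<and> (\<forall>\<pi> \<alpha>. bij \<pi> \<longrightarrow> g (image_mset \<pi> \<alpha>) = g \<alpha>)"
  from f g obtain d d' where "\<And>\<alpha>. d < size \<alpha> \<Longrightarrow> f \<alpha> = 0" "\<And>\<alpha>. d' < size \<alpha> \<Longrightarrow> g \<alpha> = 0"
    by blast
  then have "\<forall>\<gamma>. d + d' < size \<gamma> \<longrightarrow> (\<Sum>\<alpha> | \<alpha> \<subseteq># \<gamma>. f \<alpha> * g (\<gamma> - \<alpha>)) = 0"
    using symfun_conv_bounded by blast
  then show "(\<exists>d. \<forall>\<gamma>. d < size \<gamma> \<longrightarrow> (\<Sum>\<alpha> | \<alpha> \<subseteq># \<gamma>. f \<alpha> * g (\<gamma> - \<alpha>)) = 0) \<and>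
      (\<forall>\<pi> \<gamma>. bij \<pi> \<longrightarrow>
        (\<Sum>\<alpha> | \<alpha> \<subseteq># image_mset \<pi> \<gamma>. f \<alpha> * g (image_mset \<pi> \<gamma> - \<alpha>)) =
        (\<Sum>\<alpha> | \<alpha> \<subseteq># \<gamma>. f \<alpha> * g (\<gamma> - \<alpha>)))"
    using f g symfun_conv_invariant by blast
qed

instance
proof
  fix a b c :: symfun
  show "a * b * c = a * (b * c)"
  proof (transfer, rule ext)
    fix a b c :: "nat multiset \<Rightarrow> rat" and \<gamma> :: "nat multiset"
    have "(\<Sum>\<alpha> | \<alpha> \<subseteq># \<gamma>. (\<Sum>\<beta> | \<beta> \<subseteq># \<alpha>. a \<beta> * b (\<alpha> - \<beta>)) * c (\<gamma> - \<alpha>)) =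
        (\<Sum>(\<alpha>, \<beta>) \<in> Sigma {\<alpha>. \<alpha> \<subseteq># \<gamma>} (\<lambda>\<alpha>. {\<beta>. \<beta> \<subseteq># \<alpha>}). a \<beta> * b (\<alpha> - \<beta>) * c (\<gamma> - \<alpha>))"
      by (simp add: sum_distrib_right sum.Sigma finite_submultisets)
    also have "\<dots> = (\<Sum>(\<beta>, \<delta>) \<in> Sigma {\<beta>. \<beta> \<subseteq># \<gamma>} (\<lambda>\<beta>. {\<delta>. \<delta> \<subseteq># \<gamma> - \<beta>}).
          a \<beta> * (b \<delta> * c (\<gamma> - \<beta> - \<delta>)))"
      by (rule sum.reindex_bij_witness[where j = "\<lambda>(\<alpha>, \<beta>). (\<beta>, \<alpha> - \<beta>)" and i = "\<lambda>(\<beta>, \<delta>). (\<beta> + \<delta>, \<beta>)"])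
        (auto simp: subseteq_mset_def le_diff_conv2 mult.assoc
          intro: order_trans diff_le_mono add_leD1,
         (metis le_add_diff_inverse nat_add_left_cancel_le order_trans
            add_le_imp_le_diff le_diff_conv2 add.commute diff_le_mono)+)
    also have "\<dots> = (\<Sum>\<beta> | \<beta> \<subseteq># \<gamma>. a \<beta> * (\<Sum>\<delta> | \<delta> \<subseteq># \<gamma> - \<beta>. b \<delta> * c (\<gamma> - \<beta> - \<delta>)))"
      by (simp add: sum_distrib_left sum.Sigma finite_submultisets)
    finally show "(\<Sum>\<alpha> | \<alpha> \<subseteq># \<gamma>. (\<Sum>\<beta> | \<beta> \<subseteq># \<alpha>. a \<beta> * b (\<alpha> - \<beta>)) * c (\<gamma> - \<alpha>)) =
        (\<Sum>\<beta> | \<beta> \<subseteq># \<gamma>. a \<beta> * (\<Sum>\<delta> | \<delta> \<subseteq># \<gamma> - \<beta>. b \<delta> * c (\<gamma> - \<beta> - \<delta>)))" .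
  qed
  show "a * b = b * a"
  proof (transfer, rule ext)
    fix a b :: "nat multiset \<Rightarrow> rat" and \<gamma> :: "nat multiset"
    show "(\<Sum>\<alpha> | \<alpha> \<subseteq># \<gamma>. a \<alpha> * b (\<gamma> - \<alpha>)) = (\<Sum>\<alpha> | \<alpha> \<subseteq># \<gamma>. b \<alpha> * a (\<gamma> - \<alpha>))"
      by (rule sum.reindex_bij_witness[where j = "\<lambda>\<alpha>. \<gamma> - \<alpha>" and i = "\<lambda>\<alpha>. \<gamma> - \<alpha>"])
        (auto simp: subset_mset.diff_diff_right mult.commute)
  qed
  show "1 * a = a"
  proof (transfer, rule ext)
    fix a :: "nat multiset \<Rightarrow> rat" and \<gamma> :: "nat multiset"
    have "(\<Sum>\<alpha> | \<alpha> \<subseteq># \<gamma>. (if \<alpha> = {#} then 1 else 0) * a (\<gamma> - \<alpha>)) =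
        (\<Sum>\<alpha> | \<alpha> \<subseteq># \<gamma>. if \<alpha> = {#} then a \<gamma> else 0)"
      by (rule sum.cong) auto
    also have "\<dots> = a \<gamma>" by (simp add: finite_submultisets)
    finally show "(\<Sum>\<alpha> | \<alpha> \<subseteq># \<gamma>. (if \<alpha> = {#} then 1 else 0) * a (\<gamma> - \<alpha>)) = a \<gamma>" .
  qed
  show "(0 :: symfun) \<noteq> 1"
    by transfer (auto simp: fun_eq_iff)
  show "(a + b) * c = a * c + b * c"
    by transfer (simp add: fun_eq_iff distrib_right sum.distrib)
qed (transfer; simp add: fun_eq_iff)+

end

lift_definition scale_symfun :: "rat \<Rightarrow> symfun \<Rightarrow> symfun" is "\<lambda>c f \<alpha>. c * f \<alpha>"
  by (metis mult_zero_right)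

global_interpretation symfun: vector_space scale_symfun
  by standard (transfer; simp add: fun_eq_iff algebra_simps)+


section \<open>Partitions and the classical bases\<close>

text \<open>A partition is the weakly decreasing list of its positive parts; hence \<open>sum_list \<mu>\<close> is
  the size and \<open>length \<mu>\<close> the number of nonzero parts.\<close>

definition is_partition :: "nat list \<Rightarrow> bool" where
  "is_partition \<mu> \<longleftrightarrow> sorted_wrt (\<ge>) \<mu> \<and> 0 \<notin> set \<mu>"

definition exponents :: "nat multiset \<Rightarrow> nat multiset" where
  "exponents \<alpha> = image_mset (count \<alpha>) (mset_set (set_mset \<alpha>))"

lemma sum_mset_exponents: "\<Sum>\<^sub># (exponents \<alpha>) = size \<alpha>"
  by (simp add: exponents_def size_multiset_overloaded_eq sum_unfold_sum_mset)

lemma count_image_mset_bij: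
  assumes "bij \<pi>"
  shows "count (image_mset \<pi> \<alpha>) (\<pi> i) = count \<alpha> i"
proof -
  have "inj \<pi>" using assms by (rule bij_is_inj)
  then show ?thesis by (induction \<alpha>) (auto dest: injD)
qed

lemma exponents_image_mset:
  assumes "bij \<pi>"
  shows "exponents (image_mset \<pi> \<alpha>) = exponents \<alpha>"
proof -
  have "inj_on \<pi> (set_mset \<alpha>)" using assms by (meson bij_is_inj inj_on_subset subset_UNIV)
  then have "mset_set (\<pi> ` set_mset \<alpha>) = image_mset \<pi> (mset_set (set_mset \<alpha>))"
    by (simp add: image_mset_mset_set)
  then show ?thesis
    by (simp add: exponents_def multiset.map_comp comp_def count_image_mset_bij[OF assms])
qed

lift_definition m_fun :: "nat list \<Rightarrow> symfun"
  is "\<lambda>\<mu> \<alpha>. if exponents \<alpha> = mset \<mu> then 1 else 0"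
proof -
  fix \<mu> :: "nat list"
  have "exponents \<alpha> \<noteq> mset \<mu>" if "sum_list \<mu> < size \<alpha>" for \<alpha>
    using that by (metis sum_mset_exponents sum_mset_sum_list nat_neq_iff)
  then show "(\<exists>d. \<forall>\<alpha>. d < size \<alpha> \<longrightarrow> (if exponents \<alpha> = mset \<mu> then 1 else 0 :: rat) = 0) \<and>
      (\<forall>\<pi> \<alpha>. bij \<pi> \<longrightarrow> (if exponents (image_mset \<pi> \<alpha>) = mset \<mu> then 1 else 0 :: rat) =
        (if exponents \<alpha> = mset \<mu> then 1 else 0))"
    by (auto simp: exponents_image_mset)
qed

lift_definition h_gen :: "nat \<Rightarrow> symfun"
  is "\<lambda>n \<alpha>. if size \<alpha> = n then 1 else 0"
  by auto

lift_definition e_gen :: "nat \<Rightarrow> symfun"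
  is "\<lambda>n \<alpha>. if size \<alpha> = n \<and> (\<forall>i. count \<alpha> i \<le> 1) then 1 else 0"
proof -
  fix n :: nat
  have inv: "(\<forall>i. count (image_mset \<pi> \<alpha>) i \<le> 1) \<longleftrightarrow> (\<forall>i. count \<alpha> i \<le> 1)"
    if "bij \<pi>" for \<pi> :: "nat \<Rightarrow> nat" and \<alpha>
    by (metis count_image_mset_bij[OF that] bij_pointE that)
  show "(\<exists>d. \<forall>\<alpha> :: nat multiset. d < size \<alpha> \<longrightarrow>
        (if size \<alpha> = n \<and> (\<forall>i. count \<alpha> i \<le> 1) then 1 else 0 :: rat) = 0) \<and>
      (\<forall>(\<pi> :: nat \<Rightarrow> nat) \<alpha>. bij \<pi> \<longrightarrow>
        (if size (image_mset \<pi> \<alpha>) = n \<and> (\<forall>i. count (image_mset \<pi> \<alpha>) i \<le> 1) then 1 else 0 :: rat) =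
        (if size \<alpha> = n \<and> (\<forall>i. count \<alpha> i \<le> 1) then 1 else 0))"
    by (intro conjI exI[of _ n]) (simp, intro allI impI, simp only: inv size_image_mset)
qed

definition h_fun :: "nat list \<Rightarrow> symfun" where
  "h_fun \<mu> = prod_list (map h_gen \<mu>)"

definition e_fun :: "nat list \<Rightarrow> symfun" where
  "e_fun \<mu> = prod_list (map e_gen \<mu>)"

text \<open>The families \<open>m_fun\<close> and \<open>h_fun\<close>, restricted to partitions, are bases, so each of the
  following definite descriptions determines a unique object: linear maps are determined by
  their values on a basis, and \<open>hall\<close> is the bilinear form making these two bases dual.\<close>

definition omega :: "symfun \<Rightarrow> symfun" where
  "omega = (THE w. Vector_Spaces.linear scale_symfun scale_symfun w \<and>
              (\<forall>\<mu>. is_partition \<mu> \<longrightarrow> w (h_fun \<mu>) = e_fun \<mu>))"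

definition f_fun :: "nat list \<Rightarrow> symfun" where
  "f_fun \<mu> = omega (m_fun \<mu>)"

definition hall :: "symfun \<Rightarrow> symfun \<Rightarrow> rat" where
  "hall = (THE B.
      (\<forall>g. Vector_Spaces.linear scale_symfun (*) (\<lambda>f. B f g)) \<and>
      (\<forall>f. Vector_Spaces.linear scale_symfun (*) (B f)) \<and>
      (\<forall>\<mu> \<nu>. is_partition \<mu> \<longrightarrow> is_partition \<nu> \<longrightarrow>
         B (m_fun \<mu>) (h_fun \<nu>) = (if \<mu> = \<nu> then 1 else 0)))"

definition perp :: "symfun \<Rightarrow> symfun \<Rightarrow> symfun" where
  "perp g f = (THE u. \<forall>v. hall u v = hall f (g * v))"


section \<open>The operators\<close>

definition add_ones :: "nat \<Rightarrow> nat list \<Rightarrow> nat list" where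
  "add_ones k \<mu> = map Suc (\<mu> @ replicate (k - length \<mu>) 0)"

text \<open>\<open>Sum_any\<close> sums over the support of its argument.  For \<open>f\<close> of degree \<open>d\<close> the terms with
  \<open>|\<mu>| > d\<close> vanish, so this support is finite.\<close>

definition CH :: "nat \<Rightarrow> symfun \<Rightarrow> symfun" where
  "CH k f = Sum_any (\<lambda>\<mu>. if is_partition \<mu> \<and> length \<mu> \<le> k
     then (-1) ^ sum_list \<mu> * (e_fun (add_ones k \<mu>) * perp (m_fun \<mu>) f) else 0)"

definition CE :: "nat \<Rightarrow> symfun \<Rightarrow> symfun" where
  "CE k f = Sum_any (\<lambda>\<mu>. if is_partition \<mu> \<and> length \<mu> \<le> k
     then (-1) ^ sum_list \<mu> * (h_fun (add_ones k \<mu>) * perp (f_fun \<mu>) f) else 0)"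

end

(* Pairing with a product h(\<gamma>) of homogeneous generators, indexed by an exponent vector \<gamma>,
   extracts the coefficient of the monomial x^\<gamma>.  Hence the adjoint of m_\<lambda> sends h(\<gamma>) to the sum of
   h(\<gamma> - \<alpha>) over all exponent vectors \<alpha> \<le> \<gamma> that are rearrangements of \<lambda>.  Summing over
   all \<lambda> with at most k parts, every \<alpha> \<le> \<gamma> in k variables occurs once, and the sum factors as the
   product over i < k of  sum_a (-1)^a e_(a+1) h_(\<gamma>_i - a) = h_(\<gamma>_i + 1).  The second identity
   has the same proof because the involution is self-adjoint and multiplicative.

   That the Hall form and the involution exist rests on the h_\<mu> forming a basis.  They span since
   the m_\<mu> are polynomials in the power sums (induction on the number of variables), which are
   polynomials in the h_n by Newton's identities; and since the coefficient matrix of the h_\<mu> is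
   symmetric, spanning implies independence. *)
theory Submission
  imports Defs "HOL-Combinatorics.Permutations" "HOL-Library.FuncSet"
begin

section \<open>Coefficients and monomials\<close>

lemma symfun_eqI: "(\<And>\<alpha>. coeff_symfun f \<alpha> = coeff_symfun g \<alpha>) \<Longrightarrow> f = g"
  by (metis coeff_symfun_inject ext)

lemma coeff_symfun_simps [simp]:
  "coeff_symfun 0 \<alpha> = 0"
  "coeff_symfun 1 \<alpha> = (if \<alpha> = {#} then 1 else 0)"
  "coeff_symfun (f + g) \<alpha> = coeff_symfun f \<alpha> + coeff_symfun g \<alpha>"
  "coeff_symfun (f - g) \<alpha> = coeff_symfun f \<alpha> - coeff_symfun g \<alpha>"
  "coeff_symfun (- f) \<alpha> = - coeff_symfun f \<alpha>"
  "coeff_symfun (scale_symfun c f) \<alpha> = c * coeff_symfun f \<alpha>"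
  "coeff_symfun (h_gen n) \<alpha> = (if size \<alpha> = n then 1 else 0)"
  "coeff_symfun (e_gen n) \<alpha> = (if size \<alpha> = n \<and> (\<forall>i. count \<alpha> i \<le> 1) then 1 else 0)"
  "coeff_symfun (m_fun \<mu>) \<alpha> = (if exponents \<alpha> = mset \<mu> then 1 else 0)"
  by (transfer, simp)+

lemma coeff_symfun_times:
  "coeff_symfun (f * g) \<gamma> = (\<Sum>\<alpha> | \<alpha> \<subseteq># \<gamma>. coeff_symfun f \<alpha> * coeff_symfun g (\<gamma> - \<alpha>))"
  by transfer simp

lemma coeff_symfun_sum: "coeff_symfun (sum F A) \<alpha> = (\<Sum>x\<in>A. coeff_symfun (F x) \<alpha>)"
  by (induction A rule: infinite_finite_induct) auto

lemma scale_symfun_mult: "scale_symfun c (f * g) = scale_symfun c f * g"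
  by (rule symfun_eqI) (simp add: coeff_symfun_times sum_distrib_left mult.assoc)

lemma mult_scale_symfun: "f * scale_symfun c g = scale_symfun c (f * g)"
  using scale_symfun_mult[of c g f] by (simp add: mult.commute)

lemma minus_one_power_mult_eq_scale:
  "(-1) ^ n * f = scale_symfun ((-1) ^ n) f"
  by (induction n) (auto intro!: symfun_eqI)

lemma coeff_symfun_bounded: "\<exists>d. \<forall>\<alpha>. d < size \<alpha> \<longrightarrow> coeff_symfun f \<alpha> = 0"
  using coeff_symfun[of f] by blast

lemma coeff_symfun_image_mset: "bij \<pi> \<Longrightarrow> coeff_symfun f (image_mset \<pi> \<alpha>) = coeff_symfun f \<alpha>"
  using coeff_symfun[of f] by blast

lemma filter_mset_eq_self_iff: "filter_mset P M = M \<longleftrightarrow> (\<forall>x\<in>#M. P x)"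
  by (simp add: filter_mset_eq_conv)

section \<open>The shape of a monomial and its orbit under permutations of the variables\<close>

lemma size_exponents: "size (exponents \<alpha>) = card (set_mset \<alpha>)"
  by (simp add: exponents_def)

lemma zero_notin_exponents: "0 \<notin># exponents \<alpha>"
  by (auto simp: exponents_def count_eq_zero_iff)

text \<open>Variables of \<open>A\<close> outside the monomial have exponent 0. Padding with zeros
  makes monomials in different variables comparable, and later accounts for the zeros that
  \<open>add_ones\<close> appends.\<close>

lemma image_mset_count_superset:
  assumes "finite A" "set_mset \<alpha> \<subseteq> A"
  shows "image_mset (count \<alpha>) (mset_set A) =
    exponents \<alpha> + replicate_mset (card A - card (set_mset \<alpha>)) 0"
proof -
  have A: "mset_set A = mset_set (set_mset \<alpha>) + mset_set (A - set_mset \<alpha>)"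
    using assms by (metis Diff_disjoint Un_Diff_cancel finite_Diff finite_set_mset mset_set_Union
        subset_Un_eq)
  have "image_mset (count \<alpha>) (mset_set (A - set_mset \<alpha>)) =
      image_mset (\<lambda>_. 0) (mset_set (A - set_mset \<alpha>))"
    using assms by (intro image_mset_cong) (auto simp: count_eq_zero_iff)
  also have "\<dots> = replicate_mset (card A - card (set_mset \<alpha>)) 0"
    using assms by (simp add: image_mset_const_eq card_Diff_subset)
  finally show ?thesis
    unfolding A exponents_def by simp
qed

text \<open>Both monomials use equally many variables, so over the union \<open>A\<close> of their
  variables both families of exponents receive the same number of zeros. Equal multisets of values
  over \<open>A\<close> differ by a permutation of \<open>A\<close>, which fixes all other
  variables.\<close>

lemma exponents_eq_imp_permuted:
  assumes "exponents \<alpha> = exponents \<beta>"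
  shows "\<exists>\<pi>. bij \<pi> \<and> image_mset \<pi> \<alpha> = \<beta>"
proof -
  define A where "A = set_mset \<alpha> \<union> set_mset \<beta>"
  have card: "card (set_mset \<alpha>) = card (set_mset \<beta>)"
    using assms by (metis size_exponents)
  have "image_mset (count \<alpha>) (mset_set A) = image_mset (count \<beta>) (mset_set A)"
    using image_mset_count_superset[of A \<alpha>] image_mset_count_superset[of A \<beta>] assms card
    by (simp add: A_def)
  then obtain p where p: "p permutes A" "\<forall>x\<in>A. count \<alpha> x = count \<beta> (p x)"
    by (rule image_mset_eq_implies_permutes[rotated]) (auto simp: A_def)
  have bij: "bij p" using p(1) by (rule permutes_bij)
  have eq: "count \<alpha> x = count \<beta> (p x)" for x
  proof (cases "x \<in> A")
    case False
    then have "p x = x" using p(1) by (simp add: permutes_not_in)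
    with False show ?thesis by (simp add: A_def not_in_iff)
  qed (use p in auto)
  have "image_mset p \<alpha> = \<beta>"
  proof (rule multiset_eqI)
    fix y
    obtain x where "y = p x" using bij by (metis bij_pointE)
    then show "count (image_mset p \<alpha>) y = count \<beta> y"
      using count_image_mset_bij[OF bij] eq by simp
  qed
  with bij show ?thesis by blast
qed

lemma coeff_symfun_exponents_cong:
  "exponents \<alpha> = exponents \<beta> \<Longrightarrow> coeff_symfun f \<alpha> = coeff_symfun f \<beta>"
  using exponents_eq_imp_permuted coeff_symfun_image_mset by metis

section \<open>Partitions as canonical labels of the orbits\<close>

lemma is_partition_mset_inject:
  assumes "is_partition \<mu>" "is_partition \<nu>" "mset \<mu> = mset \<nu>"
  shows "\<mu> = \<nu>"
proof -
  have "sorted (rev \<mu>)" "sorted (rev \<nu>)"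
    using assms by (auto simp: is_partition_def sorted_wrt_rev)
  then show ?thesis
    using assms(3) by (metis mset_rev properties_for_sort rev_rev_ident)
qed

definition sort_partition :: "nat multiset \<Rightarrow> nat list" where
  "sort_partition M = rev (sorted_list_of_multiset M)"

lemma mset_sort_partition [simp]: "mset (sort_partition M) = M"
  by (simp add: sort_partition_def)

lemma is_partition_sort_partition: "0 \<notin># M \<Longrightarrow> is_partition (sort_partition M)"
  unfolding is_partition_def sort_partition_def
  by (auto simp: sorted_wrt_rev sorted_sorted_list_of_multiset)

text \<open>The monomial with exponent list \<open>\<nu>\<close>, where zeros are allowed. For a
  partition it is the representative of its orbit at which coefficients are read.\<close>

definition monom_mset :: "nat list \<Rightarrow> nat multiset" where
  "monom_mset \<nu> = (\<Sum>i<length \<nu>. replicate_mset (\<nu> ! i) i)"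

lemma count_sum_replicate_mset:
  "finite A \<Longrightarrow> count (\<Sum>i\<in>A. replicate_mset (c i) i) j = (if j \<in> A then c j else 0)"
  by (induction A rule: finite_induct) auto

lemma count_monom_mset:
  "count (monom_mset \<nu>) i = (if i < length \<nu> then \<nu> ! i else 0)"
  by (simp add: monom_mset_def count_sum_replicate_mset)

lemma set_mset_monom_mset: "set_mset (monom_mset \<nu>) \<subseteq> {..<length \<nu>}"
  by (auto simp: set_mset_def count_monom_mset split: if_splits)

lemma image_mset_nth_upt: "image_mset ((!) \<nu>) (mset_set {..<length \<nu>}) = mset \<nu>"
proof -
  have "mset_set {..<length \<nu>} = mset [0..<length \<nu>]"
    by (metis atLeast_upt mset_set_set distinct_upt lessThan_atLeast0 set_upt)
  then show ?thesis
    by (metis map_nth mset_map)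
qed

lemma exponents_conv_filter:
  assumes "finite A" "set_mset \<alpha> \<subseteq> A"
  shows "exponents \<alpha> = filter_mset (\<lambda>n. n \<noteq> 0) (image_mset (count \<alpha>) (mset_set A))"
proof -
  have "filter_mset (\<lambda>n. n \<noteq> 0) (exponents \<alpha>) = exponents \<alpha>"
    unfolding filter_mset_eq_self_iff using zero_notin_exponents[of \<alpha>] by metis
  moreover have "filter_mset (\<lambda>n. n \<noteq> 0) (replicate_mset m (0::nat)) = {#}" for m
    by auto
  ultimately show ?thesis
    unfolding image_mset_count_superset[OF assms] filter_union_mset by (simp only: add_0_right)
qed

lemma exponents_monom_mset: "exponents (monom_mset \<nu>) = filter_mset (\<lambda>n. n \<noteq> 0) (mset \<nu>)"
proof -
  have "image_mset (count (monom_mset \<nu>)) (mset_set {..<length \<nu>}) =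
      image_mset ((!) \<nu>) (mset_set {..<length \<nu>})"
    by (intro image_mset_cong) (auto simp: count_monom_mset)
  then show ?thesis
    using exponents_conv_filter[OF _ set_mset_monom_mset, of \<nu>] image_mset_nth_upt[of \<nu>] by simp
qed

lemma exponents_monom_mset_partition: "is_partition \<nu> \<Longrightarrow> exponents (monom_mset \<nu>) = mset \<nu>"
  unfolding exponents_monom_mset is_partition_def filter_mset_eq_self_iff
  by (metis set_mset_mset)

section \<open>Products of generators\<close>

text \<open>Both generating families at once, so that each statement about products needs one proof:
  \<open>gen_fun True\<close> is \<open>e_gen\<close> and \<open>gen_fun False\<close> is \<open>h_gen\<close>.\<close>

definition gen_fun :: "bool \<Rightarrow> nat \<Rightarrow> symfun" where
  "gen_fun q = (if q then e_gen else h_gen)"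

text \<open>A multiset serves as index so that, for homogeneous generators, the same object names
  the product and the monomial whose coefficient this product extracts under the Hall form.\<close>

definition gen_prod :: "bool \<Rightarrow> nat multiset \<Rightarrow> symfun" where
  "gen_prod q \<gamma> = (\<Prod>i\<in>set_mset \<gamma>. gen_fun q (count \<gamma> i))"

lemma h_gen_0: "h_gen 0 = 1"
  by (rule symfun_eqI) auto

lemma e_gen_0: "e_gen 0 = 1"
  by (rule symfun_eqI) auto

lemma gen_fun_0 [simp]: "gen_fun q 0 = 1"
  by (simp add: gen_fun_def h_gen_0 e_gen_0)

lemma gen_prod_superset:
  assumes "finite A" "set_mset \<gamma> \<subseteq> A"
  shows "gen_prod q \<gamma> = (\<Prod>i\<in>A. gen_fun q (count \<gamma> i))"
  unfolding gen_prod_def using assms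
  by (intro prod.mono_neutral_left) (auto simp: not_in_iff)

lemma prod_mset_filter_nonzero:
  "prod_mset (image_mset (gen_fun q) (filter_mset (\<lambda>n. n \<noteq> 0) M)) = prod_mset (image_mset (gen_fun q) M)"
  by (induction M) auto

lemma gen_prod_exponents: "gen_prod q \<gamma> = prod_mset (image_mset (gen_fun q) (exponents \<gamma>))"
  by (simp add: gen_prod_def exponents_def prod_unfold_prod_mset multiset.map_comp comp_def)

text \<open>Zero entries of \<open>\<nu>\<close> disappear from the exponents, but they contribute
  only generators of index 0, which equal 1.\<close>

lemma prod_list_gen_fun: "prod_list (map (gen_fun q) \<nu>) = gen_prod q (monom_mset \<nu>)"
  unfolding gen_prod_exponents exponents_monom_mset prod_mset_filter_nonzero
  by (metis mset_map prod_mset_prod_list)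

lemma h_fun_gen_prod: "h_fun \<nu> = gen_prod False (monom_mset \<nu>)"
  using prod_list_gen_fun[of False \<nu>] by (simp add: h_fun_def gen_fun_def)

lemma e_fun_gen_prod: "e_fun \<nu> = gen_prod True (monom_mset \<nu>)"
  using prod_list_gen_fun[of True \<nu>] by (simp add: e_fun_def gen_fun_def)

text \<open>Sorting leads from any exponent vector to a partition with the same product, so facts
  known for partitions extend to every \<open>gen_prod\<close>.\<close>

lemma h_fun_sort_partition_exponents: "h_fun (sort_partition (exponents \<gamma>)) = gen_prod False \<gamma>"
  by (simp add: h_fun_gen_prod gen_prod_exponents exponents_monom_mset_partition
      is_partition_sort_partition zero_notin_exponents)

lemma e_fun_sort_partition_exponents: "e_fun (sort_partition (exponents \<gamma>)) = gen_prod True \<gamma>"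
  by (simp add: e_fun_gen_prod gen_prod_exponents exponents_monom_mset_partition
      is_partition_sort_partition zero_notin_exponents)

section \<open>Symmetry of the coefficients of products of generators\<close>

text \<open>A multiset of pairs with marginals \<open>\<gamma>\<close> and \<open>\<delta>\<close> is a matrix of natural numbers with
  these row and column sums (a 0-1 matrix if \<open>q\<close> holds).\<close>

definition margin_msets :: "bool \<Rightarrow> nat multiset \<Rightarrow> nat multiset \<Rightarrow> (nat \<times> nat) multiset set" where
  "margin_msets q \<gamma> \<delta> = {M. image_mset fst M = \<gamma> \<and> image_mset snd M = \<delta> \<and>
     (q \<longrightarrow> (\<forall>p. count M p \<le> 1))}"

text \<open>Transposing a matrix exchanges its row sums and column sums.\<close>

lemma card_margin_msets_swap: "card (margin_msets q \<gamma> \<delta>) = card (margin_msets q \<delta> \<gamma>)"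
proof (rule bij_betw_same_card)
  have count: "count (image_mset prod.swap M) p = count M (prod.swap p)"
    for p and M :: "(nat \<times> nat) multiset"
    by (induction M) auto
  show "bij_betw (image_mset prod.swap) (margin_msets q \<gamma> \<delta>) (margin_msets q \<delta> \<gamma>)"
    by (rule bij_betw_byWitness[where f' = "image_mset prod.swap"])
      (auto simp: margin_msets_def multiset.map_comp comp_def count)
qed

lemma finite_margin_msets: "finite (margin_msets q \<gamma> \<delta>)"
proof -
  have "finite {M. size M = size \<gamma> \<and> set_mset M \<subseteq> set_mset \<gamma> \<times> set_mset \<delta>}"
  proof (rule finite_subset)
    show "{M. size M = size \<gamma> \<and> set_mset M \<subseteq> set_mset \<gamma> \<times> set_mset \<delta>} \<subseteq>
        mset ` {xs. set xs \<subseteq> set_mset \<gamma> \<times> set_mset \<delta> \<and> length xs = size \<gamma>}"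
    proof
      fix M assume M: "M \<in> {M. size M = size \<gamma> \<and> set_mset M \<subseteq> set_mset \<gamma> \<times> set_mset \<delta>}"
      obtain xs where "M = mset xs" by (metis ex_mset)
      with M show "M \<in> mset ` {xs. set xs \<subseteq> set_mset \<gamma> \<times> set_mset \<delta> \<and> length xs = size \<gamma>}"
        by auto
    qed
  qed (simp add: finite_lists_length_eq)
  moreover have "margin_msets q \<gamma> \<delta> \<subseteq> {M. size M = size \<gamma> \<and> set_mset M \<subseteq> set_mset \<gamma> \<times> set_mset \<delta>}"
    by (force simp: margin_msets_def)
  ultimately show ?thesis by (rule finite_subset[rotated])
qed

section \<open>Coefficients of products as numbers of matrices\<close>

lemma coeff_gen_fun:
  "coeff_symfun (gen_fun q n) \<alpha> = (if size \<alpha> = n \<and> (q \<longrightarrow> (\<forall>i. count \<alpha> i \<le> 1)) then 1 else 0)"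
  by (simp add: gen_fun_def)

lemma count_image_mset_Pair:
  "count (image_mset (Pair x) \<alpha>) (a, b) = (if a = x then count \<alpha> b else 0)"
  by (induction \<alpha>) auto

lemma count_image_mset_snd_filter:
  "count (image_mset snd (filter_mset (\<lambda>p. fst p = x) M)) b = count M (x, b)"
  by (induction M) auto

text \<open>A matrix splits into row \<open>x\<close>, recorded as the multiset \<alpha> of its
  column indices, and the remaining rows, whose column sums are \<delta> - \<alpha>. Because
  \<open>x\<close> does not occur in \<Gamma>, filtering by the first component recovers the two
  pieces.\<close>

lemma card_margin_msets_add:
  assumes "x \<notin># \<Gamma>"
  shows "card (margin_msets q (replicate_mset n x + \<Gamma>) \<delta>) =
    (\<Sum>\<alpha> | \<alpha> \<subseteq># \<delta> \<and> size \<alpha> = n \<and> (q \<longrightarrow> (\<forall>i. count \<alpha> i \<le> 1)). card (margin_msets q \<Gamma> (\<delta> - \<alpha>)))"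
proof -
  define S where "S = {\<alpha>. \<alpha> \<subseteq># \<delta> \<and> size \<alpha> = n \<and> (q \<longrightarrow> (\<forall>i. count \<alpha> i \<le> 1))}"
  define join where "join = (\<lambda>(\<alpha> :: nat multiset, M). image_mset (Pair x) \<alpha> + M)"
  define split where "split = (\<lambda>M :: (nat \<times> nat) multiset.
    (image_mset snd (filter_mset (\<lambda>p. fst p = x) M), filter_mset (\<lambda>p. fst p \<noteq> x) M))"
  have no_x: "(x, b) \<notin># M" if "image_mset fst M = \<Gamma>" for b and M :: "(nat \<times> nat) multiset"
  proof
    assume "(x, b) \<in># M"
    then have "fst (x, b) \<in> fst ` set_mset M" by (rule imageI)
    with assms that show False by (metis fst_conv set_image_mset)
  qed
  have "bij_betw join (Sigma S (\<lambda>\<alpha>. margin_msets q \<Gamma> (\<delta> - \<alpha>)))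
      (margin_msets q (replicate_mset n x + \<Gamma>) \<delta>)"
  proof (rule bij_betw_byWitness[where f' = split])
    show "\<forall>p\<in>Sigma S (\<lambda>\<alpha>. margin_msets q \<Gamma> (\<delta> - \<alpha>)). split (join p) = p"
    proof safe
      fix \<alpha> M assume "M \<in> margin_msets q \<Gamma> (\<delta> - \<alpha>)"
      then have M: "filter_mset (\<lambda>p. fst p = x) M = {#}" "filter_mset (\<lambda>p. fst p \<noteq> x) M = M"
        using no_x[of M] by (auto simp: margin_msets_def filter_mset_eq_self_iff)
      show "split (join (\<alpha>, M)) = (\<alpha>, M)"
        by (simp add: split_def join_def M filter_mset_image_mset multiset.map_comp comp_def)
    qed
    show "\<forall>M\<in>margin_msets q (replicate_mset n x + \<Gamma>) \<delta>. join (split M) = M"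
    proof
      fix M :: "(nat \<times> nat) multiset"
      have "image_mset (\<lambda>p. (x, snd p)) (filter_mset (\<lambda>p. fst p = x) M) =
          image_mset (\<lambda>p. p) (filter_mset (\<lambda>p. fst p = x) M)"
        by (intro image_mset_cong) auto
      then show "join (split M) = M"
        by (simp add: split_def join_def multiset.map_comp comp_def)
    qed
    show "join ` (Sigma S (\<lambda>\<alpha>. margin_msets q \<Gamma> (\<delta> - \<alpha>))) \<subseteq> margin_msets q (replicate_mset n x + \<Gamma>) \<delta>"
    proof safe
      fix \<alpha> M assume \<alpha>: "\<alpha> \<in> S" and M: "M \<in> margin_msets q \<Gamma> (\<delta> - \<alpha>)"
      have "count M (x, b) = 0" for b
        using M no_x[of M b] by (simp add: margin_msets_def not_in_iff)
      with \<alpha> M have "q \<longrightarrow> (\<forall>p. count (image_mset (Pair x) \<alpha> + M) p \<le> 1)"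
        by (auto simp: S_def margin_msets_def count_image_mset_Pair)
      with \<alpha> M show "join (\<alpha>, M) \<in> margin_msets q (replicate_mset n x + \<Gamma>) \<delta>"
        by (auto simp: S_def margin_msets_def join_def multiset.map_comp comp_def image_mset_const_eq)
    qed
    show "split ` (margin_msets q (replicate_mset n x + \<Gamma>) \<delta>) \<subseteq> Sigma S (\<lambda>\<alpha>. margin_msets q \<Gamma> (\<delta> - \<alpha>))"
    proof (rule image_subsetI)
      fix M assume M: "M \<in> margin_msets q (replicate_mset n x + \<Gamma>) \<delta>"
      define A B where "A = filter_mset (\<lambda>p. fst p = x) M" and "B = filter_mset (\<lambda>p. fst p \<noteq> x) M"
      have M_eq: "M = A + B" unfolding A_def B_def by (rule multiset_partition)
      have fst_A: "image_mset fst A = filter_mset (\<lambda>i. i = x) (replicate_mset n x + \<Gamma>)"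
        using M image_mset_filter_mset_swap[of fst "\<lambda>i. i = x" M] by (simp add: A_def margin_msets_def)
      have fst_B: "image_mset fst B = filter_mset (\<lambda>i. i \<noteq> x) (replicate_mset n x + \<Gamma>)"
        using M image_mset_filter_mset_swap[of fst "\<lambda>i. i \<noteq> x" M] by (simp add: B_def margin_msets_def)
      have "filter_mset (\<lambda>i. i = x) \<Gamma> = {#}" "filter_mset (\<lambda>i. i \<noteq> x) \<Gamma> = \<Gamma>"
        using assms by (auto simp: filter_mset_eq_self_iff)
      moreover have "filter_mset (\<lambda>i. i = x) (replicate_mset n x) = replicate_mset n x"
        "filter_mset (\<lambda>i. i \<noteq> x) (replicate_mset n x) = {#}"
        by (auto intro: multiset_eqI)
      ultimately have "size (image_mset fst A) = n" "image_mset fst B = \<Gamma>"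
        using fst_A fst_B by simp_all
      moreover have "image_mset snd A + image_mset snd B = \<delta>"
        using M M_eq by (auto simp: margin_msets_def)
      moreover have "q \<longrightarrow> count (image_mset snd A) i \<le> 1" for i
        using M by (simp add: A_def count_image_mset_snd_filter margin_msets_def)
      moreover have "q \<longrightarrow> count B p \<le> 1" for p
        using M by (cases p) (simp add: B_def margin_msets_def)
      ultimately show "split M \<in> Sigma S (\<lambda>\<alpha>. margin_msets q \<Gamma> (\<delta> - \<alpha>))"
        by (auto simp: S_def split_def margin_msets_def simp flip: A_def B_def)
    qed
  qed
  then have "card (margin_msets q (replicate_mset n x + \<Gamma>) \<delta>) =
      card (Sigma S (\<lambda>\<alpha>. margin_msets q \<Gamma> (\<delta> - \<alpha>)))"
    by (simp add: bij_betw_same_card)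
  also have "\<dots> = (\<Sum>\<alpha>\<in>S. card (margin_msets q \<Gamma> (\<delta> - \<alpha>)))"
    by (rule card_SigmaI) (auto simp: S_def finite_margin_msets intro: finite_subset[OF _ finite_submultisets])
  finally show ?thesis by (simp add: S_def)
qed

text \<open>Each factor distributes its degree over the variables and so fills one row of a matrix.
  Peeling off the factor of \<open>x\<close> gives the recursion of
  \<open>card_margin_msets_add\<close>; \<delta> is general because the other factors must produce
  \<delta> - \<alpha>.\<close>

lemma coeff_prod_gen_fun:
  assumes "finite A"
  shows "coeff_symfun (\<Prod>i\<in>A. gen_fun q (c i)) \<delta> =
    of_nat (card (margin_msets q (\<Sum>i\<in>A. replicate_mset (c i) i) \<delta>))"
  using assms
proof (induction A arbitrary: \<delta> rule: finite_induct)
  case empty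
  have "margin_msets q {#} \<delta> = (if \<delta> = {#} then {{#}} else {})"
    by (auto simp: margin_msets_def)
  then show ?case by simp
next
  case (insert x A)
  let ?\<Gamma> = "\<Sum>i\<in>A. replicate_mset (c i) i"
  have "x \<notin># ?\<Gamma>"
    using insert.hyps by (simp add: not_in_iff count_sum_replicate_mset)
  note card = card_margin_msets_add[OF this, of q "c x" \<delta>]
  have "coeff_symfun (\<Prod>i\<in>insert x A. gen_fun q (c i)) \<delta> =
      (\<Sum>\<alpha> | \<alpha> \<subseteq># \<delta>. (if size \<alpha> = c x \<and> (q \<longrightarrow> (\<forall>i. count \<alpha> i \<le> 1)) then 1 else 0) *
        of_nat (card (margin_msets q ?\<Gamma> (\<delta> - \<alpha>))))"
    using insert.hyps by (simp add: coeff_symfun_times coeff_gen_fun insert.IH del: coeff_symfun_simps)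
  also have "\<dots> = (\<Sum>\<alpha> | \<alpha> \<subseteq># \<delta> \<and> size \<alpha> = c x \<and> (q \<longrightarrow> (\<forall>i. count \<alpha> i \<le> 1)).
        of_nat (card (margin_msets q ?\<Gamma> (\<delta> - \<alpha>))))"
    by (rule sum.mono_neutral_cong_right) (auto simp: finite_submultisets)
  finally show ?case using insert.hyps by (simp add: card)
qed

lemma coeff_gen_prod_commute:
  "coeff_symfun (gen_prod q \<gamma>) \<delta> = coeff_symfun (gen_prod q \<delta>) \<gamma>"
proof -
  have "coeff_symfun (gen_prod q \<gamma>) \<delta> = of_nat (card (margin_msets q \<gamma> \<delta>))" for \<gamma> \<delta>
  proof -
    have "(\<Sum>i\<in>set_mset \<gamma>. replicate_mset (count \<gamma> i) i) = \<gamma>"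
      by (intro multiset_eqI) (auto simp: count_sum_replicate_mset not_in_iff)
    then show ?thesis
      unfolding gen_prod_def by (simp add: coeff_prod_gen_fun)
  qed
  then show ?thesis using card_margin_msets_swap by simp
qed

section \<open>The spanning families\<close>

lemma linear_iff_symfun:
  "Vector_Spaces.linear scale_symfun scale_symfun w \<longleftrightarrow>
    (\<forall>f g. w (f + g) = w f + w g) \<and> (\<forall>c f. w (scale_symfun c f) = scale_symfun c (w f))"
  by (auto simp: Vector_Spaces.linear_def module_hom_def module_hom_axioms_def
      symfun.vector_space_axioms symfun.module_axioms)

lemma vector_space_rat: "vector_space ((*) :: rat \<Rightarrow> rat \<Rightarrow> rat)"
  by standard (auto simp: algebra_simps)

lemma linear_iff_rat:
  "Vector_Spaces.linear scale_symfun ((*) :: rat \<Rightarrow> rat \<Rightarrow> rat) L \<longleftrightarrow>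
    (\<forall>f g. L (f + g) = L f + L g) \<and> (\<forall>c f. L (scale_symfun c f) = c * L f)"
  by (auto simp: Vector_Spaces.linear_def module_hom_def module_hom_axioms_def
      symfun.vector_space_axioms symfun.module_axioms vector_space_rat
      vector_space_rat[unfolded module_iff_vector_space[symmetric]])

section \<open>Spanning by the monomial symmetric functions\<close>

lemma ex_partition: "\<exists>\<mu>. is_partition \<mu> \<and> mset \<mu> = exponents \<alpha>"
  using is_partition_sort_partition[OF zero_notin_exponents] mset_sort_partition by blast

lemma length_le_sum_list_partition: "is_partition \<mu> \<Longrightarrow> length \<mu> \<le> sum_list \<mu>"
proof (induction \<mu>)
  case (Cons a \<mu>)
  then show ?case by (cases a) (auto simp: is_partition_def)
qed auto

lemma finite_partitions: "finite {\<mu>. is_partition \<mu> \<and> sum_list \<mu> \<le> d}"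
proof (rule finite_subset)
  show "{\<mu>. is_partition \<mu> \<and> sum_list \<mu> \<le> d} \<subseteq> {\<mu>. set \<mu> \<subseteq> {..d} \<and> length \<mu> \<le> d}"
    using member_le_sum_list length_le_sum_list_partition by (fastforce intro: order_trans)
qed (rule finite_lists_length_le, simp)

text \<open>The coefficients of \<open>f\<close> at the representatives
  \<open>monom_mset \<mu>\<close> are its coordinates, and the degree bound makes the sum finite.
  The bound \<open>l\<close> on the number of variables is tracked because
  \<open>few_variables_in_h_span\<close> is an induction on it.\<close>

lemma in_span_m_fun:
  assumes "\<And>\<alpha>. coeff_symfun f \<alpha> \<noteq> 0 \<Longrightarrow> card (set_mset \<alpha>) \<le> l"
  shows "f \<in> symfun.span (m_fun ` {\<mu>. is_partition \<mu> \<and> length \<mu> \<le> l})"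
proof -
  obtain d where d: "\<And>\<alpha>. d < size \<alpha> \<Longrightarrow> coeff_symfun f \<alpha> = 0"
    using coeff_symfun_bounded by blast
  define P where "P = {\<mu>. is_partition \<mu> \<and> sum_list \<mu> \<le> d \<and> length \<mu> \<le> l}"
  have fin: "finite P"
    by (rule finite_subset[OF _ finite_partitions[of d]]) (auto simp: P_def)
  define g where "g = (\<Sum>\<mu>\<in>P. scale_symfun (coeff_symfun f (monom_mset \<mu>)) (m_fun \<mu>))"
  have "f = g"
  proof (rule symfun_eqI)
    fix \<alpha>
    obtain \<nu> where \<nu>: "is_partition \<nu>" "mset \<nu> = exponents \<alpha>"
      using ex_partition by blast
    have eq: "exponents \<alpha> = mset \<mu> \<longleftrightarrow> \<mu> = \<nu>" if "is_partition \<mu>" for \<mu>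
      using that \<nu> is_partition_mset_inject by metis
    have "coeff_symfun g \<alpha> = (\<Sum>\<mu>\<in>P. if \<mu> = \<nu> then coeff_symfun f (monom_mset \<nu>) else 0)"
      unfolding g_def coeff_symfun_sum by (rule sum.cong) (auto simp: P_def eq)
    also have "\<dots> = (if \<nu> \<in> P then coeff_symfun f (monom_mset \<nu>) else 0)"
      using fin by simp
    also have "coeff_symfun f (monom_mset \<nu>) = coeff_symfun f \<alpha>"
      using \<nu> by (intro coeff_symfun_exponents_cong) (simp add: exponents_monom_mset_partition)
    also have "(if \<nu> \<in> P then coeff_symfun f \<alpha> else 0) = coeff_symfun f \<alpha>"
    proof (cases "coeff_symfun f \<alpha> = 0")
      case False
      have "sum_list \<nu> = size \<alpha>"
        by (metis \<nu>(2) sum_mset_exponents sum_mset_sum_list)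
      moreover have "length \<nu> = card (set_mset \<alpha>)"
        by (metis \<nu>(2) size_exponents size_mset)
      ultimately show ?thesis
        using False d assms \<nu>(1) by (auto simp: P_def not_less[symmetric])
    qed simp
    finally show "coeff_symfun f \<alpha> = coeff_symfun g \<alpha>" by simp
  qed
  also have "g \<in> symfun.span (m_fun ` {\<mu>. is_partition \<mu> \<and> length \<mu> \<le> l})"
    unfolding g_def by (intro symfun.span_sum symfun.span_scale symfun.span_base) (auto simp: P_def)
  finally show ?thesis .
qed

lemma span_m_fun: "symfun.span (m_fun ` Collect is_partition) = UNIV"
proof -
  have "f \<in> symfun.span (m_fun ` Collect is_partition)" for f
  proof -
    obtain d where d: "\<And>\<alpha>. d < size \<alpha> \<Longrightarrow> coeff_symfun f \<alpha> = 0"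
      using coeff_symfun_bounded by blast
    have "card (set_mset \<alpha>) \<le> size \<alpha>" for \<alpha> :: "nat multiset"
      using length_le_sum_list_partition ex_partition
      by (metis size_exponents size_mset sum_mset_exponents sum_mset_sum_list)
    then have "card (set_mset \<alpha>) \<le> d" if "coeff_symfun f \<alpha> \<noteq> 0" for \<alpha>
      using that d by (meson le_trans not_le)
    then have "f \<in> symfun.span (m_fun ` {\<mu>. is_partition \<mu> \<and> length \<mu> \<le> d})"
      by (rule in_span_m_fun)
    moreover have "m_fun ` {\<mu>. is_partition \<mu> \<and> length \<mu> \<le> d} \<subseteq> m_fun ` Collect is_partition"
      by auto
    ultimately show ?thesis using symfun.span_mono by blast
  qed
  then show ?thesis by auto
qed

section \<open>The subalgebra spanned by the products of homogeneous generators\<close>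

definition h_span :: "symfun set" where
  "h_span = symfun.span (h_fun ` Collect is_partition)"

lemma h_fun_in_h_span: "h_fun \<mu> \<in> h_span"
proof -
  have "h_fun \<mu> = h_fun (sort_partition (exponents (monom_mset \<mu>)))"
    unfolding h_fun_sort_partition_exponents by (rule h_fun_gen_prod)
  then show ?thesis
    unfolding h_span_def
    by (metis imageI is_partition_sort_partition mem_Collect_eq symfun.span_base zero_notin_exponents)
qed

lemma h_fun_mult: "h_fun \<mu> * h_fun \<nu> = h_fun (\<mu> @ \<nu>)"
  by (simp add: h_fun_def)

text \<open>Concatenating index lists multiplies the products. The concatenation need not be sorted,
  which is why \<open>h_fun_in_h_span\<close> covers arbitrary lists. The two inductions use
  linearity in each factor.\<close>

lemma h_span_mult:
  assumes "f \<in> h_span" "g \<in> h_span"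
  shows "f * g \<in> h_span"
proof -
  have *: "h_fun \<mu> * g \<in> h_span" for \<mu>
    using assms(2) unfolding h_span_def
  proof (induction rule: symfun.span_induct_alt)
    case base
    then show ?case by (simp add: symfun.span_zero)
  next
    case (step c x y)
    then obtain \<nu> where "x = h_fun \<nu>" by auto
    then have "h_fun \<mu> * (scale_symfun c x + y) = scale_symfun c (h_fun (\<mu> @ \<nu>)) + h_fun \<mu> * y"
      by (simp add: distrib_left mult_scale_symfun flip: h_fun_mult)
    with step h_fun_in_h_span show ?case
      by (metis h_span_def symfun.span_add symfun.span_scale)
  qed
  show ?thesis
    using assms(1) unfolding h_span_def
  proof (induction rule: symfun.span_induct_alt)
    case base
    then show ?case by (simp add: symfun.span_zero)
  next
    case (step c x y)
    then show ?case
      using * by (auto simp: distrib_right h_span_def symfun.span_add symfun.span_scale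
          simp flip: scale_symfun_mult)
  qed
qed

lemma h_span_diff: "f \<in> h_span \<Longrightarrow> g \<in> h_span \<Longrightarrow> f - g \<in> h_span"
  and h_span_scale: "f \<in> h_span \<Longrightarrow> scale_symfun c f \<in> h_span"
  and h_span_sum: "(\<And>x. x \<in> A \<Longrightarrow> F x \<in> h_span) \<Longrightarrow> sum F A \<in> h_span"
  by (simp_all add: h_span_def symfun.span_diff symfun.span_scale symfun.span_sum)

lemma h_gen_in_h_span: "h_gen n \<in> h_span"
  using h_fun_in_h_span[of "[n]"] by (simp add: h_fun_def)

lemma one_in_h_span: "1 \<in> h_span"
  using h_fun_in_h_span[of "[]"] by (simp add: h_fun_def)

section \<open>Power sums and Newton's identities\<close>

lemma exponents_eq_singleton_iff:
  "0 < n \<Longrightarrow> exponents \<alpha> = {#n#} \<longleftrightarrow> (\<exists>i. \<alpha> = replicate_mset n i)"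
proof (intro iffI)
  assume n: "0 < n" and \<alpha>: "exponents \<alpha> = {#n#}"
  then have "card (set_mset \<alpha>) = 1" by (metis size_exponents size_single)
  then obtain i where i: "set_mset \<alpha> = {i}" by (auto simp: card_1_singleton_iff)
  with \<alpha> have "count \<alpha> i = n" by (simp add: exponents_def)
  with i show "\<exists>i. \<alpha> = replicate_mset n i"
    by (metis set_mset_subset_singletonD subset_refl count_replicate_mset)
qed (auto simp: exponents_def)

lemma submultisets_power_sum:
  assumes "0 < r"
  shows "{\<alpha>. \<alpha> \<subseteq># \<gamma> \<and> exponents \<alpha> = {#r#}} = replicate_mset r ` {i. r \<le> count \<gamma> i}"
  using assms by (auto simp: exponents_eq_singleton_iff simp flip: count_le_replicate_mset_subset_eq)

lemma inj_replicate_mset: "0 < r \<Longrightarrow> inj_on (replicate_mset r) A"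
  by (auto simp: inj_on_def replicate_mset_eq_iff)

text \<open>\<open>m_fun [r]\<close> is the power sum of degree \<open>r\<close>, so only the
  divisors of \<gamma> that are an \<open>r\<close>-th power of one variable contribute to the
  convolution.\<close>

lemma coeff_power_sum_mult:
  assumes "0 < r"
  shows "coeff_symfun (m_fun [r] * f) \<gamma> =
    (\<Sum>i | r \<le> count \<gamma> i. coeff_symfun f (\<gamma> - replicate_mset r i))"
proof -
  have "coeff_symfun (m_fun [r] * f) \<gamma> =
      (\<Sum>\<alpha> | \<alpha> \<subseteq># \<gamma> \<and> exponents \<alpha> = {#r#}. coeff_symfun f (\<gamma> - \<alpha>))"
    unfolding coeff_symfun_times
    by (rule sum.mono_neutral_cong_right) (auto simp: finite_submultisets)
  then show ?thesis
    using assms by (simp add: submultisets_power_sum sum.reindex inj_replicate_mset)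
qed

lemma finite_count_ge: "0 < r \<Longrightarrow> finite {i. r \<le> count \<gamma> i}"
  by (rule finite_subset[OF _ finite_set_mset[of \<gamma>]]) (auto simp flip: count_greater_zero_iff)

text \<open>At a monomial of degree \<open>n\<close> the right side counts the pairs
  \<open>(r, i)\<close> with 1 \<le> r \<le> \<open>count \<gamma> i\<close>, and summing the
  exponents gives \<open>n\<close>. In any other degree both sides vanish.\<close>

lemma newton_h_gen:
  "scale_symfun (of_nat n) (h_gen n) = (\<Sum>r\<in>{1..n}. m_fun [r] * h_gen (n - r))"
proof (rule symfun_eqI)
  fix \<gamma>
  have "coeff_symfun (\<Sum>r\<in>{1..n}. m_fun [r] * h_gen (n - r)) \<gamma> =
      (\<Sum>r\<in>{1..n}. \<Sum>i | r \<le> count \<gamma> i. if size \<gamma> = n then 1 else 0)"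
  proof -
    have "size (\<gamma> - replicate_mset r i) = n - r \<longleftrightarrow> size \<gamma> = n"
      if "r \<in> {1..n}" "r \<le> count \<gamma> i" for r i
    proof -
      have "replicate_mset r i \<subseteq># \<gamma>"
        using that by (simp flip: count_le_replicate_mset_subset_eq)
      then have "size (\<gamma> - replicate_mset r i) = size \<gamma> - r" "r \<le> size \<gamma>"
        using size_Diff_submset size_mset_mono by fastforce+
      with that show ?thesis by auto
    qed
    then show ?thesis
      by (auto simp: coeff_symfun_sum coeff_power_sum_mult intro!: sum.cong)
  qed
  also have "\<dots> = (if size \<gamma> = n then of_nat n else 0)"
  proof (cases "size \<gamma> = n")
    case True
    have "(\<Sum>r\<in>{1..n}. \<Sum>i | r \<le> count \<gamma> i. 1 :: nat) =
        (\<Sum>r\<in>{1..n}. \<Sum>i | i \<in># \<gamma> \<and> r \<le> count \<gamma> i. 1)"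
      by (intro sum.cong) (auto simp flip: count_greater_zero_iff)
    also have "\<dots> = (\<Sum>i\<in>set_mset \<gamma>. \<Sum>r | r \<in> {1..n} \<and> r \<le> count \<gamma> i. 1)"
      by (rule sum.swap_restrict) auto
    also have "\<dots> = (\<Sum>i\<in>set_mset \<gamma>. count \<gamma> i)"
    proof (rule sum.cong)
      fix i
      have "{r. r \<in> {1..n} \<and> r \<le> count \<gamma> i} = {1..count \<gamma> i}"
        using True count_le_size[of \<gamma> i] by auto
      then show "(\<Sum>r | r \<in> {1..n} \<and> r \<le> count \<gamma> i. 1) = count \<gamma> i" by simp
    qed simp
    also have "\<dots> = n" using True by (simp add: size_multiset_overloaded_eq)
    finally have "of_nat (\<Sum>r\<in>{1..n}. \<Sum>i | r \<le> count \<gamma> i. 1 :: nat) = (of_nat n :: rat)" by simp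
    with True show ?thesis by simp
  qed simp
  finally show "coeff_symfun (scale_symfun (of_nat n) (h_gen n)) \<gamma> =
      coeff_symfun (\<Sum>r\<in>{1..n}. m_fun [r] * h_gen (n - r)) \<gamma>" by simp
qed

text \<open>In Newton's identity the term \<open>r = n\<close> is the power sum itself, since
  \<open>h_gen 0\<close> is 1; all other terms involve smaller power sums.\<close>

lemma power_sum_in_h_span: "0 < n \<Longrightarrow> m_fun [n] \<in> h_span"
proof (induction n rule: less_induct)
  case (less n)
  have "{1..n} = insert n {1..<n}" using less.prems by auto
  then have "scale_symfun (of_nat n) (h_gen n) =
      m_fun [n] + (\<Sum>r\<in>{1..<n}. m_fun [r] * h_gen (n - r))"
    unfolding newton_h_gen by (simp add: h_gen_0)
  then have "m_fun [n] =
      scale_symfun (of_nat n) (h_gen n) - (\<Sum>r\<in>{1..<n}. m_fun [r] * h_gen (n - r))"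
    by simp
  also have "\<dots> \<in> h_span"
    using less by (intro h_span_diff h_span_scale h_gen_in_h_span h_span_sum h_span_mult) auto
  finally show ?case .
qed

section \<open>Reducing monomial functions to power sums\<close>

lemma exponents_add_replicate_mset:
  assumes "i \<notin># \<beta>" "0 < n"
  shows "exponents (\<beta> + replicate_mset n i) = add_mset n (exponents \<beta>)"
proof -
  have "set_mset (\<beta> + replicate_mset n i) = insert i (set_mset \<beta>)" using assms by auto
  moreover have "image_mset (count (\<beta> + replicate_mset n i)) (mset_set (set_mset \<beta>)) = exponents \<beta>"
    unfolding exponents_def using assms by (intro image_mset_cong) auto
  ultimately show ?thesis using assms by (simp add: exponents_def not_in_iff)
qed

text \<open>Multiplying a monomial of shape \<open>\<mu>\<close> by the \<open>n\<close>-th power of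
  a variable either brings in a new variable, giving shape \<open>n # \<mu>\<close>, or raises an
  existing exponent and keeps \<open>length \<mu>\<close> variables. Subtracting the first kind with
  its multiplicity \<open>c\<close> leaves only the second.\<close>

lemma power_sum_mult_m_fun:
  assumes "is_partition (n # \<mu>)"
  shows "\<exists>c. c \<noteq> 0 \<and> (\<forall>\<alpha>. coeff_symfun (m_fun [n] * m_fun \<mu> - scale_symfun c (m_fun (n # \<mu>))) \<alpha> \<noteq> 0
    \<longrightarrow> card (set_mset \<alpha>) \<le> length \<mu>)"
proof -
  have n: "0 < n" and \<mu>: "is_partition \<mu>" using assms by (auto simp: is_partition_def)
  define c where "c = coeff_symfun (m_fun [n] * m_fun \<mu>) (monom_mset (n # \<mu>))"
  have coeff: "coeff_symfun (m_fun [n] * m_fun \<mu>) \<gamma> =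
      of_nat (card {i. n \<le> count \<gamma> i \<and> exponents (\<gamma> - replicate_mset n i) = mset \<mu>})" for \<gamma>
  proof -
    have "coeff_symfun (m_fun [n] * m_fun \<mu>) \<gamma> =
        (\<Sum>i | n \<le> count \<gamma> i \<and> exponents (\<gamma> - replicate_mset n i) = mset \<mu>. 1)"
      unfolding coeff_power_sum_mult[OF n]
      by (rule sum.mono_neutral_cong_right) (auto simp: finite_count_ge[OF n])
    then show ?thesis by simp
  qed
  have "c \<noteq> 0"
  proof -
    define i where "i = length \<mu>"
    define \<gamma> where "\<gamma> = monom_mset \<mu> + replicate_mset n i"
    have "i \<notin># monom_mset \<mu>" by (simp add: not_in_iff count_monom_mset i_def)
    then have "exponents \<gamma> = mset (n # \<mu>)"
      using n \<mu> by (simp add: \<gamma>_def exponents_add_replicate_mset exponents_monom_mset_partition)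
    then have "c = coeff_symfun (m_fun [n] * m_fun \<mu>) \<gamma>"
      unfolding c_def using assms
      by (intro coeff_symfun_exponents_cong) (simp add: exponents_monom_mset_partition)
    moreover have "i \<in> {i. n \<le> count \<gamma> i \<and> exponents (\<gamma> - replicate_mset n i) = mset \<mu>}"
      using \<mu> by (simp add: \<gamma>_def exponents_monom_mset_partition)
    moreover have "finite {i. n \<le> count \<gamma> i \<and> exponents (\<gamma> - replicate_mset n i) = mset \<mu>}"
      by (rule finite_subset[OF _ finite_count_ge[OF n, of \<gamma>]]) auto
    ultimately show ?thesis
      unfolding coeff by (metis card_eq_0_iff empty_iff of_nat_eq_0_iff)
  qed
  moreover have "card (set_mset \<alpha>) \<le> length \<mu>"
    if \<alpha>: "coeff_symfun (m_fun [n] * m_fun \<mu> - scale_symfun c (m_fun (n # \<mu>))) \<alpha> \<noteq> 0" for \<alpha>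
  proof -
    have exp: "exponents \<alpha> \<noteq> mset (n # \<mu>)"
    proof
      assume *: "exponents \<alpha> = mset (n # \<mu>)"
      then have "coeff_symfun (m_fun [n] * m_fun \<mu>) \<alpha> = c"
        unfolding c_def using assms
        by (intro coeff_symfun_exponents_cong) (simp add: exponents_monom_mset_partition)
      with \<alpha> * show False by simp
    qed
    with \<alpha> have "coeff_symfun (m_fun [n] * m_fun \<mu>) \<alpha> \<noteq> 0" by auto
    then have "{i. n \<le> count \<alpha> i \<and> exponents (\<alpha> - replicate_mset n i) = mset \<mu>} \<noteq> {}"
      unfolding coeff by force
    then obtain i where i: "n \<le> count \<alpha> i" "exponents (\<alpha> - replicate_mset n i) = mset \<mu>"
      by auto
    define \<beta> where "\<beta> = \<alpha> - replicate_mset n i"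
    have \<alpha>_eq: "\<alpha> = \<beta> + replicate_mset n i"
      using i(1) by (simp add: \<beta>_def count_le_replicate_mset_subset_eq)
    \<comment> \<open>Otherwise variable \<open>i\<close> would be new and \<alpha> would have the
      shape that \<open>exp\<close> excludes.\<close>
    have "i \<in># \<beta>"
      using exponents_add_replicate_mset[of i \<beta> n] n exp i(2) by (auto simp: \<alpha>_eq \<beta>_def[symmetric])
    then have "set_mset \<alpha> = set_mset \<beta>" using n by (auto simp: \<alpha>_eq)
    then show ?thesis
      by (metis \<beta>_def i(2) le_refl size_exponents size_mset)
  qed
  ultimately show ?thesis by blast
qed

text \<open>Induction on the number of variables. By \<open>power_sum_mult_m_fun\<close>, a monomial
  function with \<open>Suc l\<close> parts is, up to a nonzero factor, a power sum times a monomial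
  function with \<open>l\<close> parts, minus a remainder in at most \<open>l\<close> variables. The
  claim is made for arbitrary \<open>f\<close> so that it applies to this remainder.\<close>

lemma few_variables_in_h_span:
  "(\<And>\<alpha>. coeff_symfun f \<alpha> \<noteq> 0 \<Longrightarrow> card (set_mset \<alpha>) \<le> l) \<Longrightarrow> f \<in> h_span"
proof (induction l arbitrary: f)
  case 0
  have "f = scale_symfun (coeff_symfun f {#}) 1"
    using 0 by (intro symfun_eqI) (auto simp: card_eq_0_iff)
  then show ?case using one_in_h_span h_span_scale by metis
next
  case (Suc l)
  have m: "m_fun \<mu> \<in> h_span" if \<mu>: "is_partition \<mu>" "length \<mu> \<le> Suc l" for \<mu>
  proof (cases "length \<mu> \<le> l")
    case True
    show ?thesis
    proof (rule Suc.IH)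
      fix \<alpha> assume "coeff_symfun (m_fun \<mu>) \<alpha> \<noteq> 0"
      then have "exponents \<alpha> = mset \<mu>" by (simp split: if_splits)
      with True show "card (set_mset \<alpha>) \<le> l" by (metis size_exponents size_mset)
    qed
  next
    case False
    then obtain n \<nu> where \<mu>_eq: "\<mu> = n # \<nu>" using \<mu> by (cases \<mu>) auto
    have \<nu>: "is_partition \<nu>" "length \<nu> \<le> l" "0 < n" using \<mu> by (auto simp: \<mu>_eq is_partition_def)
    have "m_fun \<nu> \<in> h_span"
    proof (rule Suc.IH)
      fix \<alpha> assume "coeff_symfun (m_fun \<nu>) \<alpha> \<noteq> 0"
      then have "exponents \<alpha> = mset \<nu>" by (simp split: if_splits)
      with \<nu> show "card (set_mset \<alpha>) \<le> l" by (metis size_exponents size_mset)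
    qed
    obtain c where c: "c \<noteq> 0"
      "\<And>\<alpha>. coeff_symfun (m_fun [n] * m_fun \<nu> - scale_symfun c (m_fun \<mu>)) \<alpha> \<noteq> 0 \<Longrightarrow>
        card (set_mset \<alpha>) \<le> length \<nu>"
      using power_sum_mult_m_fun[of n \<nu>] \<mu>(1) unfolding \<mu>_eq by blast
    define g where "g = m_fun [n] * m_fun \<nu> - scale_symfun c (m_fun \<mu>)"
    have "g \<in> h_span"
      using c(2) \<nu>(2) unfolding g_def by (intro Suc.IH) (meson le_trans)
    moreover have "m_fun \<mu> = scale_symfun (1 / c) (m_fun [n] * m_fun \<nu> - g)"
      using c(1) by (simp add: g_def)
    ultimately show ?thesis
      using \<open>m_fun \<nu> \<in> h_span\<close> power_sum_in_h_span[OF \<nu>(3)]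
      by (metis h_span_diff h_span_mult h_span_scale)
  qed
  have "symfun.span (m_fun ` {\<mu>. is_partition \<mu> \<and> length \<mu> \<le> Suc l}) \<subseteq> h_span"
    unfolding h_span_def
    by (rule symfun.span_minimal) (use m in \<open>auto simp: h_span_def\<close>)
  with in_span_m_fun[OF Suc.prems] show ?case by blast
qed

lemma span_h_fun: "symfun.span (h_fun ` Collect is_partition) = UNIV"
proof -
  have "m_fun \<mu> \<in> h_span" for \<mu>
  proof (rule few_variables_in_h_span)
    fix \<alpha> assume "coeff_symfun (m_fun \<mu>) \<alpha> \<noteq> 0"
    then have "exponents \<alpha> = mset \<mu>" by (simp split: if_splits)
    then show "card (set_mset \<alpha>) \<le> length \<mu>" by (metis le_refl size_exponents size_mset)
  qed
  then have "symfun.span (m_fun ` Collect is_partition) \<subseteq> h_span"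
    unfolding h_span_def by (intro symfun.span_minimal) auto
  then show ?thesis by (auto simp: span_m_fun h_span_def)
qed

section \<open>Independence of the homogeneous family\<close>

lemma coeff_h_fun_commute:
  "coeff_symfun (h_fun \<mu>) (monom_mset \<nu>) = coeff_symfun (h_fun \<nu>) (monom_mset \<mu>)"
  unfolding h_fun_gen_prod by (rule coeff_gen_prod_commute)

lemma coeff_m_fun_monom_mset:
  "is_partition \<mu> \<Longrightarrow> is_partition \<nu> \<Longrightarrow>
    coeff_symfun (m_fun \<mu>) (monom_mset \<nu>) = (if \<mu> = \<nu> then 1 else 0)"
  using is_partition_mset_inject[of \<mu> \<nu>] by (auto simp: exponents_monom_mset_partition)

text \<open>The matrix of coefficients of the \<open>h_fun \<mu>\<close> is symmetric, so a left kernel vector \<open>c\<close>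
  is a linear functional vanishing on the spanning family \<open>h_fun \<nu>\<close>, hence zero.\<close>

lemma h_fun_coeffs_eq_0:
  assumes S: "finite S" "S \<subseteq> Collect is_partition"
    and sum: "(\<Sum>\<mu>\<in>S. scale_symfun (c \<mu>) (h_fun \<mu>)) = 0" and \<nu>: "\<nu> \<in> S"
  shows "c \<nu> = 0"
proof -
  define L where "L = (\<lambda>v. \<Sum>\<mu>\<in>S. c \<mu> * coeff_symfun v (monom_mset \<mu>))"
  have L_h: "L (h_fun \<nu>) = 0" for \<nu>
  proof -
    have "L (h_fun \<nu>) = coeff_symfun (\<Sum>\<mu>\<in>S. scale_symfun (c \<mu>) (h_fun \<mu>)) (monom_mset \<nu>)"
      by (simp add: L_def coeff_symfun_sum coeff_h_fun_commute[of \<nu>])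
    with sum show ?thesis by simp
  qed
  have L_add: "L (scale_symfun a f + g) = a * L f + L g" for a f g
    by (simp add: L_def distrib_left sum.distrib sum_distrib_left mult.left_commute)
  have "L v = 0" for v
  proof -
    have "v \<in> symfun.span (h_fun ` Collect is_partition)" by (simp add: span_h_fun)
    then show ?thesis
    proof (induction rule: symfun.span_induct_alt)
      case base
      show ?case by (simp add: L_def)
    next
      case (step a x y)
      then show ?case using L_h by (auto simp: L_add)
    qed
  qed
  \<comment> \<open>The coefficients of \<open>m_fun \<nu>\<close> at the representatives form a
    unit vector, so \<open>L\<close> reads off \<open>c \<nu>\<close>.\<close>
  moreover have "L (m_fun \<nu>) = (\<Sum>\<mu>\<in>S. if \<mu> = \<nu> then c \<nu> else 0)"
    unfolding L_def using S \<nu>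
    by (intro sum.cong) (auto simp: coeff_m_fun_monom_mset subset_eq simp del: coeff_symfun_simps)
  ultimately show ?thesis using S \<nu> by simp
qed

text \<open>Two distinct partitions with the same product would give a linear relation with
  coefficients 1 and -1.\<close>

lemma inj_on_h_fun: "inj_on h_fun (Collect is_partition)"
proof (rule inj_onI, rule ccontr)
  fix \<mu> \<nu> assume *: "\<mu> \<in> Collect is_partition" "\<nu> \<in> Collect is_partition" "h_fun \<mu> = h_fun \<nu>" "\<mu> \<noteq> \<nu>"
  have "(if \<mu> = \<mu> then 1 else -1 :: rat) = 0"
    by (rule h_fun_coeffs_eq_0[of "{\<mu>, \<nu>}" "\<lambda>\<kappa>. if \<kappa> = \<mu> then 1 else -1"]) (use * in auto)
  then show False by simp
qed

lemma independent_h_fun: "symfun.independent (h_fun ` Collect is_partition)"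
proof (unfold symfun.independent_explicit_finite_subsets, safe)
  fix S u v
  assume S: "S \<subseteq> h_fun ` Collect is_partition" "finite S" "(\<Sum>v\<in>S. scale_symfun (u v) v) = 0" "v \<in> S"
  define T where "T = {\<mu>. is_partition \<mu> \<and> h_fun \<mu> \<in> S}"
  have S_eq: "S = h_fun ` T" and inj: "inj_on h_fun T"
    using S(1) inj_on_h_fun by (auto simp: T_def inj_on_def)
  with S(2) have "finite T" using finite_imageD by blast
  moreover have "(\<Sum>\<mu>\<in>T. scale_symfun (u (h_fun \<mu>)) (h_fun \<mu>)) = 0"
    using S(3) inj by (simp add: S_eq sum.reindex)
  moreover obtain \<nu> where "\<nu> \<in> T" "v = h_fun \<nu>" using S(4) S_eq by auto
  ultimately show "u v = 0"
    using h_fun_coeffs_eq_0[of T "\<lambda>\<mu>. u (h_fun \<mu>)" \<nu>] by (auto simp: T_def)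
qed

section \<open>Linear maps prescribed or compared on a basis\<close>

lemma ex_linear_on_h_fun:
  assumes "vector_space s"
  shows "\<exists>L. Vector_Spaces.linear scale_symfun s L \<and> (\<forall>\<mu>. is_partition \<mu> \<longrightarrow> L (h_fun \<mu>) = g \<mu>)"
proof -
  interpret vector_space_pair scale_symfun s
    by (intro vector_space_pair.intro symfun.vector_space_axioms assms)
  \<comment> \<open>Injectivity of \<open>h_fun\<close> on partitions lets values indexed by
    partitions be read as values on the basis.\<close>
  obtain L where "Vector_Spaces.linear scale_symfun s L"
    "\<forall>x\<in>h_fun ` Collect is_partition. L x = g (inv_into (Collect is_partition) h_fun x)"
    using linear_independent_extend[OF independent_h_fun,
        of "\<lambda>x. g (inv_into (Collect is_partition) h_fun x)"] by blast
  then show ?thesis using inj_on_h_fun by (intro exI[of _ L]) auto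
qed

lemma linear_eq_on_h_fun:
  assumes "vector_space s" "Vector_Spaces.linear scale_symfun s L" "Vector_Spaces.linear scale_symfun s L'"
    and "\<And>\<mu>. is_partition \<mu> \<Longrightarrow> L (h_fun \<mu>) = L' (h_fun \<mu>)"
  shows "L f = L' f"
proof -
  interpret vector_space_pair scale_symfun s
    by (intro vector_space_pair.intro symfun.vector_space_axioms assms)
  show ?thesis
    by (rule linear_eq_on[OF assms(2,3), of _ "h_fun ` Collect is_partition"])
      (use assms(4) in \<open>auto simp: span_h_fun\<close>)
qed

lemma linear_eq_on_m_fun:
  assumes "vector_space s" "Vector_Spaces.linear scale_symfun s L" "Vector_Spaces.linear scale_symfun s L'"
    and "\<And>\<mu>. is_partition \<mu> \<Longrightarrow> L (m_fun \<mu>) = L' (m_fun \<mu>)"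
  shows "L f = L' f"
proof -
  interpret vector_space_pair scale_symfun s
    by (intro vector_space_pair.intro symfun.vector_space_axioms assms)
  show ?thesis
    by (rule linear_eq_on[OF assms(2,3), of _ "m_fun ` Collect is_partition"])
      (use assms(4) in \<open>auto simp: span_m_fun\<close>)
qed

section \<open>The Hall form and adjoints\<close>

text \<open>The description of \<open>hall\<close> under a name, so that existence and uniqueness
  can be proved separately.\<close>

definition dual_form :: "(symfun \<Rightarrow> symfun \<Rightarrow> rat) \<Rightarrow> bool" where
  "dual_form B \<longleftrightarrow>
      (\<forall>g. Vector_Spaces.linear scale_symfun (*) (\<lambda>f. B f g)) \<and>
      (\<forall>f. Vector_Spaces.linear scale_symfun (*) (B f)) \<and>
      (\<forall>\<mu> \<nu>. is_partition \<mu> \<longrightarrow> is_partition \<nu> \<longrightarrow>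
         B (m_fun \<mu>) (h_fun \<nu>) = (if \<mu> = \<nu> then 1 else 0))"

lemma dual_form_unique:
  assumes "dual_form B" "dual_form B'"
  shows "B = B'"
proof (intro ext)
  fix f g
  have lin: "Vector_Spaces.linear scale_symfun (*) (\<lambda>f. B f g)"
    "Vector_Spaces.linear scale_symfun (*) (\<lambda>f. B' f g)"
    "Vector_Spaces.linear scale_symfun (*) (B f)"
    "Vector_Spaces.linear scale_symfun (*) (B' f)" for f g
    using assms unfolding dual_form_def by simp_all
  show "B f g = B' f g"
  proof (rule linear_eq_on_m_fun[OF vector_space_rat lin(1,2)])
    fix \<mu> assume \<mu>: "is_partition \<mu>"
    show "B (m_fun \<mu>) g = B' (m_fun \<mu>) g"
    proof (rule linear_eq_on_h_fun[OF vector_space_rat lin(3,4)])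
      show "B (m_fun \<mu>) (h_fun \<nu>) = B' (m_fun \<mu>) (h_fun \<nu>)" if "is_partition \<nu>" for \<nu>
        using assms \<mu> that unfolding dual_form_def by simp
    qed
  qed
qed

text \<open>Duality forces \<open>B f (h_fun \<nu>)\<close> to be the coordinate of \<open>f\<close>
  at \<open>m_fun \<nu>\<close>, that is, a coefficient of \<open>f\<close>. Each \<open>B f\<close>
  is extended linearly from these values; linearity in \<open>f\<close> holds because it holds for
  coefficients and can be checked on the basis.\<close>

lemma ex_dual_form: "\<exists>B. dual_form B"
proof -
  have "\<exists>B. \<forall>f. Vector_Spaces.linear scale_symfun (*) (B f) \<and>
      (\<forall>\<nu>. is_partition \<nu> \<longrightarrow> B f (h_fun \<nu>) = coeff_symfun f (monom_mset \<nu>))"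
    by (intro choice allI ex_linear_on_h_fun[OF vector_space_rat])
  then obtain B where lin: "\<And>f. Vector_Spaces.linear scale_symfun (*) (B f)"
    and B: "\<And>f \<nu>. is_partition \<nu> \<Longrightarrow> B f (h_fun \<nu>) = coeff_symfun f (monom_mset \<nu>)"
    by blast
  have "B (f + f') g = B f g + B f' g" for f f' g
  proof (rule linear_eq_on_h_fun[OF vector_space_rat, of "B (f + f')" "\<lambda>g. B f g + B f' g"])
    show "Vector_Spaces.linear scale_symfun (*) (\<lambda>g. B f g + B f' g)"
      using lin by (simp add: linear_iff_rat algebra_simps)
  qed (auto simp: lin B)
  moreover have "B (scale_symfun c f) g = c * B f g" for c f g
  proof (rule linear_eq_on_h_fun[OF vector_space_rat, of "B (scale_symfun c f)" "\<lambda>g. c * B f g"])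
    show "Vector_Spaces.linear scale_symfun (*) (\<lambda>g. c * B f g)"
      using lin by (simp add: linear_iff_rat algebra_simps)
  qed (auto simp: lin B)
  ultimately have "dual_form B"
    using lin B coeff_m_fun_monom_mset by (simp add: dual_form_def linear_iff_rat del: coeff_symfun_simps)
  then show ?thesis by (rule exI[of dual_form])
qed

lemma dual_form_hall: "dual_form hall"
proof -
  have "hall = (THE B. dual_form B)"
    by (simp add: hall_def dual_form_def)
  then show ?thesis using ex_dual_form dual_form_unique by (metis theI)
qed

lemma linear_hall_left: "Vector_Spaces.linear scale_symfun (*) (\<lambda>f. hall f g)"
  and linear_hall_right: "Vector_Spaces.linear scale_symfun (*) (hall f)"
  using dual_form_hall by (auto simp: dual_form_def)

lemma hall_add_left: "hall (f + f') g = hall f g + hall f' g"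
  and hall_scale_left: "hall (scale_symfun c f) g = c * hall f g"
  using linear_hall_left by (auto simp: linear_iff_rat)

lemma hall_sum_left: "hall (sum F A) g = (\<Sum>x\<in>A. hall (F x) g)"
proof -
  have "hall 0 g = 0" using hall_scale_left[of 0 0 g] by simp
  then show ?thesis
    by (induction A rule: infinite_finite_induct) (auto simp: hall_add_left)
qed

text \<open>For partitions this is duality extended linearly in \<open>f\<close>. It passes to every
  exponent vector because both sides depend only on the exponents of \<gamma>.\<close>

lemma hall_gen_prod_right: "hall f (gen_prod False \<gamma>) = coeff_symfun f \<gamma>"
proof -
  have "hall f (h_fun \<nu>) = coeff_symfun f (monom_mset \<nu>)" if "is_partition \<nu>" for \<nu>
  proof (rule linear_eq_on_m_fun[OF vector_space_rat])
    show "Vector_Spaces.linear scale_symfun (*) (\<lambda>f. hall f (h_fun \<nu>))"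
      by (rule linear_hall_left)
    show "Vector_Spaces.linear scale_symfun (*) (\<lambda>f. coeff_symfun f (monom_mset \<nu>))"
      by (simp add: linear_iff_rat)
    show "hall (m_fun \<mu>) (h_fun \<nu>) = coeff_symfun (m_fun \<mu>) (monom_mset \<nu>)" if "is_partition \<mu>" for \<mu>
      using dual_form_hall that \<open>is_partition \<nu>\<close> by (simp add: coeff_m_fun_monom_mset dual_form_def
          del: coeff_symfun_simps)
  qed
  then have "hall f (gen_prod False \<gamma>) = coeff_symfun f (monom_mset (sort_partition (exponents \<gamma>)))"
    unfolding h_fun_sort_partition_exponents[symmetric]
    by (simp add: is_partition_sort_partition zero_notin_exponents)
  also have "\<dots> = coeff_symfun f \<gamma>"
    by (intro coeff_symfun_exponents_cong)
      (simp add: exponents_monom_mset_partition is_partition_sort_partition zero_notin_exponents)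
  finally show ?thesis .
qed

text \<open>By bilinearity it suffices to compare homogeneous products, whose pairings form the
  symmetric coefficient matrix.\<close>

lemma hall_commute: "hall f g = hall g f"
proof (rule linear_eq_on_h_fun[OF vector_space_rat linear_hall_left linear_hall_right])
  fix \<mu>
  show "hall (h_fun \<mu>) g = hall g (h_fun \<mu>)"
  proof (rule linear_eq_on_h_fun[OF vector_space_rat linear_hall_right linear_hall_left])
    fix \<nu>
    show "hall (h_fun \<mu>) (h_fun \<nu>) = hall (h_fun \<nu>) (h_fun \<mu>)"
      by (simp add: h_fun_gen_prod hall_gen_prod_right coeff_gen_prod_commute)
  qed
qed

lemma hall_gen_prod_left: "hall (gen_prod False \<gamma>) v = coeff_symfun v \<gamma>"
  using hall_gen_prod_right hall_commute by simp

text \<open>Pairing with the products \<open>gen_prod False \<gamma>\<close> recovers every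
  coefficient, so the form is nondegenerate and the description of the adjoint has at most one
  solution.\<close>

lemma perp_eqI:
  assumes "\<And>v. hall u v = hall f (g * v)"
  shows "perp g f = u"
  unfolding perp_def
proof (rule the_equality)
  fix w assume "\<forall>v. hall w v = hall f (g * v)"
  with assms have "hall w (gen_prod False \<gamma>) = hall u (gen_prod False \<gamma>)" for \<gamma> by simp
  then show "w = u" by (intro symfun_eqI) (simp add: hall_gen_prod_right)
qed (use assms in auto)

text \<open>The pairing is the coefficient of the product at \<gamma>. In this convolution
  \<open>m_fun \<mu>\<close> selects the divisors of shape \<open>\<mu>\<close>, and the remaining
  coefficients of \<open>v\<close> are again pairings.\<close>

lemma hall_gen_prod_m_fun_mult:
  "hall (gen_prod False \<gamma>) (m_fun \<mu> * v) =
    (\<Sum>\<alpha> | \<alpha> \<subseteq># \<gamma> \<and> exponents \<alpha> = mset \<mu>. hall (gen_prod False (\<gamma> - \<alpha>)) v)"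
  unfolding hall_gen_prod_left coeff_symfun_times
  by (rule sum.mono_neutral_cong_right) (auto simp: finite_submultisets)

lemma perp_m_fun_gen_prod:
  "perp (m_fun \<mu>) (gen_prod False \<gamma>) =
    (\<Sum>\<alpha> | \<alpha> \<subseteq># \<gamma> \<and> exponents \<alpha> = mset \<mu>. gen_prod False (\<gamma> - \<alpha>))"
  by (rule perp_eqI) (simp add: hall_sum_left hall_gen_prod_m_fun_mult)

section \<open>The involution\<close>

lemma omega_unique:
  assumes "Vector_Spaces.linear scale_symfun scale_symfun w" "Vector_Spaces.linear scale_symfun scale_symfun w'"
    and "\<And>\<mu>. is_partition \<mu> \<Longrightarrow> w (h_fun \<mu>) = w' (h_fun \<mu>)"
  shows "w = w'"
  using linear_eq_on_h_fun[OF symfun.vector_space_axioms assms] by blast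

lemma linear_omega: "Vector_Spaces.linear scale_symfun scale_symfun omega"
  and omega_h_fun: "is_partition \<mu> \<Longrightarrow> omega (h_fun \<mu>) = e_fun \<mu>"
proof -
  let ?P = "\<lambda>w. Vector_Spaces.linear scale_symfun scale_symfun w \<and>
    (\<forall>\<mu>. is_partition \<mu> \<longrightarrow> w (h_fun \<mu>) = e_fun \<mu>)"
  obtain w where "?P w"
    using ex_linear_on_h_fun[OF symfun.vector_space_axioms] by blast
  have "?P omega"
    unfolding omega_def
  proof (rule theI[of ?P, OF \<open>?P w\<close>])
    show "w' = w" if "?P w'" for w'
      by (rule omega_unique) (use that \<open>?P w\<close> in simp_all)
  qed
  then show "Vector_Spaces.linear scale_symfun scale_symfun omega"
    "is_partition \<mu> \<Longrightarrow> omega (h_fun \<mu>) = e_fun \<mu>" by auto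
qed

lemma omega_add: "omega (f + g) = omega f + omega g"
  and omega_scale: "omega (scale_symfun c f) = scale_symfun c (omega f)"
  using linear_omega by (auto simp: linear_iff_symfun)

lemma omega_gen_prod: "omega (gen_prod False \<gamma>) = gen_prod True \<gamma>"
  using omega_h_fun[OF is_partition_sort_partition[OF zero_notin_exponents], of \<gamma>]
  by (simp add: h_fun_sort_partition_exponents e_fun_sort_partition_exponents)

lemma omega_h_fun_list: "omega (h_fun \<nu>) = e_fun \<nu>"
  by (simp add: h_fun_gen_prod e_fun_gen_prod omega_gen_prod)

lemma omega_1: "omega 1 = 1"
  using omega_h_fun_list[of "[]"] by (simp add: h_fun_def e_fun_def)

lemma omega_h_gen: "omega (h_gen n) = e_gen n"
  using omega_h_fun_list[of "[n]"] by (simp add: h_fun_def e_fun_def)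

text \<open>Bilinearity reduces the claim to homogeneous products, where both sides are the
  elementary product of the concatenated lists.\<close>

lemma omega_mult: "omega (f * g) = omega f * omega g"
proof (rule linear_eq_on_h_fun[OF symfun.vector_space_axioms,
      where L = "\<lambda>f. omega (f * g)" and L' = "\<lambda>f. omega f * omega g"])
  show "Vector_Spaces.linear scale_symfun scale_symfun (\<lambda>f. omega (f * g))"
    "Vector_Spaces.linear scale_symfun scale_symfun (\<lambda>f. omega f * omega g)"
    by (auto simp: linear_iff_symfun distrib_right omega_add omega_scale simp flip: scale_symfun_mult)
  fix \<mu>
  show "omega (h_fun \<mu> * g) = omega (h_fun \<mu>) * omega g"
  proof (rule linear_eq_on_h_fun[OF symfun.vector_space_axioms,
        where L = "\<lambda>g. omega (h_fun \<mu> * g)" and L' = "\<lambda>g. omega (h_fun \<mu>) * omega g"])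
    have "h_fun \<mu> * scale_symfun c g = scale_symfun c (h_fun \<mu> * g)"
      "omega (h_fun \<mu>) * scale_symfun c g = scale_symfun c (omega (h_fun \<mu>) * g)" for c g
      by (simp_all add: mult_scale_symfun)
    then show "Vector_Spaces.linear scale_symfun scale_symfun (\<lambda>g. omega (h_fun \<mu> * g))"
      "Vector_Spaces.linear scale_symfun scale_symfun (\<lambda>g. omega (h_fun \<mu>) * omega g)"
      by (auto simp: linear_iff_symfun distrib_left omega_add omega_scale)
    show "omega (h_fun \<mu> * h_fun \<nu>) = omega (h_fun \<mu>) * omega (h_fun \<nu>)" for \<nu>
      by (simp add: h_fun_mult omega_h_fun_list) (simp add: e_fun_def)
  qed
qed

lemma omega_sum: "omega (sum F A) = (\<Sum>x\<in>A. omega (F x))"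
proof -
  have "omega 0 = 0" using omega_scale[of 0 0] by simp
  then show ?thesis by (induction A rule: infinite_finite_induct) (auto simp: omega_add)
qed

lemma omega_prod: "omega (prod F A) = (\<Prod>x\<in>A. omega (F x))"
  by (induction A rule: infinite_finite_induct) (auto simp: omega_1 omega_mult)

section \<open>The alternating relation between elementary and homogeneous generators\<close>

text \<open>The sum is the expansion of a nonempty product of factors -1 + 1.\<close>

lemma sum_minus_one_power_card_Pow:
  assumes "finite A" "A \<noteq> {}"
  shows "(\<Sum>S\<in>Pow A. (-1) ^ card S) = (0 :: rat)"
proof -
  have "(\<Prod>x\<in>A. -1 + 1 :: rat) = (\<Sum>S\<in>Pow A. (\<Prod>x\<in>S. -1) * (\<Prod>x\<in>A - S. 1))"
    by (rule prod_add[OF assms(1)])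
  with assms show ?thesis by (simp add: power_0_left)
qed

text \<open>The coefficient at a monomial of degree \<open>n\<close> is the signed count of its
  squarefree divisors. These correspond to the subsets of its set of variables, which is nonempty
  because \<open>n\<close> is positive.\<close>

lemma sum_alternating_e_gen_h_gen:
  assumes "0 < n"
  shows "(\<Sum>i\<le>n. (-1) ^ i * (e_gen i * h_gen (n - i))) = 0"
proof (rule symfun_eqI)
  fix \<gamma>
  let ?sq = "\<lambda>\<alpha> :: nat multiset. \<forall>i. count \<alpha> i \<le> 1"
  have "coeff_symfun (\<Sum>i\<le>n. (-1) ^ i * (e_gen i * h_gen (n - i))) \<gamma> =
      (\<Sum>i\<le>n. \<Sum>\<alpha> | \<alpha> \<subseteq># \<gamma>. if size \<alpha> = i \<and> ?sq \<alpha> \<and> size \<gamma> = n then (-1) ^ i else 0)"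
    unfolding coeff_symfun_sum minus_one_power_mult_eq_scale coeff_symfun_simps coeff_symfun_times
      sum_distrib_left
  proof (intro sum.cong refl)
    fix i \<alpha> assume *: "i \<in> {..n}" "\<alpha> \<in> {\<alpha>. \<alpha> \<subseteq># \<gamma>}"
    then have "size (\<gamma> - \<alpha>) = size \<gamma> - size \<alpha>" "size \<alpha> \<le> size \<gamma>"
      using size_Diff_submset size_mset_mono by auto
    then have "size \<alpha> = i \<Longrightarrow> size (\<gamma> - \<alpha>) = n - i \<longleftrightarrow> size \<gamma> = n"
      using * by auto
    then show "(-1) ^ i * ((if size \<alpha> = i \<and> ?sq \<alpha> then 1 else 0) * (if size (\<gamma> - \<alpha>) = n - i then 1 else 0)) =
        (if size \<alpha> = i \<and> ?sq \<alpha> \<and> size \<gamma> = n then (-1) ^ i else (0 :: rat))"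
      by auto
  qed
  also have "\<dots> = 0"
  proof (cases "size \<gamma> = n")
    case True
    have "(\<Sum>i\<le>n. \<Sum>\<alpha> | \<alpha> \<subseteq># \<gamma>. if size \<alpha> = i \<and> ?sq \<alpha> then (-1) ^ i else 0 :: rat) =
        (\<Sum>\<alpha> | \<alpha> \<subseteq># \<gamma>. \<Sum>i\<le>n. if size \<alpha> = i then (if ?sq \<alpha> then (-1) ^ i else 0) else 0)"
      by (subst sum.swap) (intro sum.cong refl, auto)
    also have "\<dots> = (\<Sum>\<alpha> | \<alpha> \<subseteq># \<gamma>. if ?sq \<alpha> then (-1) ^ size \<alpha> else 0)"
      using size_mset_mono[of _ \<gamma>] True by (intro sum.cong refl) simp
    also have "\<dots> = (\<Sum>\<alpha> | \<alpha> \<subseteq># \<gamma> \<and> ?sq \<alpha>. (-1) ^ size \<alpha>)"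
      by (rule sum.mono_neutral_cong_right) (auto simp: finite_submultisets)
    also have "\<dots> = (\<Sum>S\<in>Pow (set_mset \<gamma>). (-1) ^ card S)"
    proof (rule sum.reindex_bij_witness[where i = mset_set and j = set_mset])
      fix \<alpha> assume "\<alpha> \<in> {\<alpha>. \<alpha> \<subseteq># \<gamma> \<and> ?sq \<alpha>}"
      then have \<alpha>: "\<alpha> \<subseteq># \<gamma>" "\<And>i. count \<alpha> i \<le> 1" by auto
      show eq: "mset_set (set_mset \<alpha>) = \<alpha>"
      proof (rule multiset_eqI)
        show "count (mset_set (set_mset \<alpha>)) i = count \<alpha> i" for i
          using \<alpha>(2)[of i] by (auto simp: count_mset_set' simp flip: count_greater_zero_iff)
      qed
      show "set_mset \<alpha> \<in> Pow (set_mset \<gamma>)" using \<alpha>(1) by (auto dest: mset_subset_eqD)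
      show "(-1) ^ card (set_mset \<alpha>) = (-1 :: rat) ^ size \<alpha>" by (metis eq size_mset_set)
    next
      fix S assume S: "S \<in> Pow (set_mset \<gamma>)"
      then have fin: "finite S" using finite_subset by auto
      then show "set_mset (mset_set S) = S" by simp
      have "mset_set S \<subseteq># \<gamma>"
        using S by (metis PowD finite_set_mset mset_set_set_mset_msubset subset_imp_msubset_mset_set
            subset_mset.order_trans)
      then show "mset_set S \<in> {\<alpha>. \<alpha> \<subseteq># \<gamma> \<and> ?sq \<alpha>}"
        by (auto simp: count_mset_set')
    qed
    also have "\<dots> = 0"
      using True assms by (intro sum_minus_one_power_card_Pow) auto
    finally show ?thesis using True by simp
  qed simp
  finally show "coeff_symfun (\<Sum>i\<le>n. (-1) ^ i * (e_gen i * h_gen (n - i))) \<gamma> = coeff_symfun 0 \<gamma>"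
    by simp
qed

lemma sum_alternating_gen_fun:
  assumes "0 < n"
  shows "(\<Sum>i\<le>n. (-1) ^ i * (gen_fun (\<not> q) i * gen_fun q (n - i))) = 0"
proof (cases q)
  case True
  \<comment> \<open>Reversing the summation exchanges the two families at the cost of a global
    sign.\<close>
  have "(\<Sum>i\<le>n. (-1) ^ i * (h_gen i * e_gen (n - i))) =
      (\<Sum>i\<le>n. (-1) ^ (n - i) * (h_gen (n - i) * e_gen (n - (n - i))))"
    by (rule sum.reindex_bij_witness[where i = "\<lambda>i. n - i" and j = "\<lambda>i. n - i"]) auto
  also have "\<dots> = (\<Sum>i\<le>n. (-1) ^ n * ((-1) ^ i * (e_gen i * h_gen (n - i))))"
  proof (rule sum.cong)
    fix i assume "i \<in> {..n}"
    then have i: "i \<le> n" by simp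
    then have "(-1 :: symfun) ^ (n - i) = (-1) ^ n * (-1) ^ i"
      by (auto simp: minus_one_power_iff)
    then show "(-1) ^ (n - i) * (h_gen (n - i) * e_gen (n - (n - i))) =
        (-1) ^ n * ((-1) ^ i * (e_gen i * h_gen (n - i)))"
      using i by (simp only: diff_diff_cancel mult.assoc mult.commute[of "e_gen i"])
  qed simp
  also have "\<dots> = 0"
    by (simp only: sum_distrib_left[symmetric] sum_alternating_e_gen_h_gen[OF assms] mult_zero_right)
  finally show ?thesis using True by (simp add: gen_fun_def)
next
  case False
  then show ?thesis using sum_alternating_e_gen_h_gen[OF assms] by (simp add: gen_fun_def)
qed

text \<open>The alternating relation in degree \<open>Suc n\<close> with the index shifted by one:
  the term of index 0 becomes the right side, and the shift reverses the sign of the others. This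
  evaluates the factor of a single variable in the creation operator.\<close>

lemma gen_fun_Suc_eq_sum:
  "(\<Sum>a\<le>n. (-1) ^ a * (gen_fun (\<not> q) (Suc a) * gen_fun q (n - a))) = gen_fun q (Suc n)"
proof -
  have "0 = (\<Sum>i\<le>Suc n. (-1) ^ i * (gen_fun (\<not> q) i * gen_fun q (Suc n - i)))"
    by (simp only: sum_alternating_gen_fun zero_less_Suc)
  also have "\<dots> = gen_fun q (Suc n) -
      (\<Sum>a\<le>n. (-1) ^ a * (gen_fun (\<not> q) (Suc a) * gen_fun q (n - a)))"
    by (simp add: sum.atMost_Suc_shift sum_negf del: sum.atMost_Suc)
  finally show ?thesis by simp
qed

section \<open>The involution squares to the identity\<close>

lemma omega_minus_one_power_mult: "omega ((-1) ^ n * f) = (-1) ^ n * omega f"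
  by (simp add: minus_one_power_mult_eq_scale omega_scale)

text \<open>Applying \<open>omega\<close> to the alternating relation shows that
  \<open>omega (e_gen n)\<close> satisfies the recursion that determines \<open>h_gen n\<close> from
  the smaller generators.\<close>

lemma omega_e_gen: "omega (e_gen n) = h_gen n"
proof (induction n rule: less_induct)
  case (less n)
  show ?case
  proof (cases "n = 0")
    case True
    then show ?thesis by (simp add: e_gen_0 h_gen_0 omega_1)
  next
    case False
    have "0 = omega (\<Sum>i\<le>n. (-1) ^ i * (e_gen i * h_gen (n - i)))"
      using False omega_scale[of 0 0] by (simp add: sum_alternating_e_gen_h_gen)
    also have "\<dots> = (\<Sum>i\<le>n. (-1) ^ i * (omega (e_gen i) * e_gen (n - i)))"
      unfolding omega_sum omega_minus_one_power_mult by (simp add: omega_mult omega_h_gen)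
    also have "\<dots> = (\<Sum>i<n. (-1) ^ i * (h_gen i * e_gen (n - i))) + (-1) ^ n * omega (e_gen n)"
      using less by (simp add: e_gen_0 flip: lessThan_Suc_atMost)
    finally have *: "(\<Sum>i<n. (-1) ^ i * (h_gen i * e_gen (n - i))) + (-1) ^ n * omega (e_gen n) = 0"
      by simp
    have "(\<Sum>i<n. (-1) ^ i * (h_gen i * e_gen (n - i))) + (-1) ^ n * h_gen n = 0"
      using sum_alternating_gen_fun[of n True] False
      by (simp add: gen_fun_def e_gen_0 flip: lessThan_Suc_atMost)
    with * have "(-1) ^ n * omega (e_gen n) = (-1) ^ n * h_gen n"
      by (metis add_left_cancel)
    \<comment> \<open>The sign is a unit equal to its own inverse, so multiplying by it once more
      cancels it.\<close>
    then have "(-1) ^ n * ((-1) ^ n * omega (e_gen n)) = (-1) ^ n * ((-1) ^ n * h_gen n)"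
      by simp
    moreover have "(-1 :: symfun) ^ n * (-1) ^ n = 1"
      by (auto simp: minus_one_power_iff)
    ultimately show ?thesis
      by (simp only: mult.assoc[symmetric] mult_1_left)
  qed
qed

lemma omega_gen_prod_True: "omega (gen_prod True \<gamma>) = gen_prod False \<gamma>"
  by (simp add: gen_prod_def omega_prod gen_fun_def omega_e_gen)

lemma omega_omega: "omega (omega f) = f"
proof (rule linear_eq_on_h_fun[OF symfun.vector_space_axioms,
      where L = "\<lambda>f. omega (omega f)" and L' = "\<lambda>f. f"])
  show "omega (omega (h_fun \<mu>)) = h_fun \<mu>" for \<mu>
    by (simp add: h_fun_gen_prod omega_gen_prod omega_gen_prod_True)
qed (simp_all add: linear_iff_symfun omega_add omega_scale)

text \<open>\<open>omega\<close> is self-adjoint because the numbers of 0-1 matrices with given row and column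
  sums form a symmetric matrix.\<close>

lemma hall_omega_left: "hall (omega f) g = hall f (omega g)"
proof (rule linear_eq_on_h_fun[OF vector_space_rat, where L = "\<lambda>f. hall (omega f) g" and L' = "\<lambda>f. hall f (omega g)"])
  show "Vector_Spaces.linear scale_symfun (*) (\<lambda>f. hall (omega f) g)"
    by (simp add: linear_iff_rat omega_add omega_scale hall_add_left hall_scale_left)
  show "Vector_Spaces.linear scale_symfun (*) (\<lambda>f. hall f (omega g))"
    by (rule linear_hall_left)
  fix \<mu>
  show "hall (omega (h_fun \<mu>)) g = hall (h_fun \<mu>) (omega g)"
  proof (rule linear_eq_on_h_fun[OF vector_space_rat, where L = "hall (omega (h_fun \<mu>))"
        and L' = "\<lambda>g. hall (h_fun \<mu>) (omega g)"])
    show "Vector_Spaces.linear scale_symfun (*) (\<lambda>g. hall (h_fun \<mu>) (omega g))"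
      using linear_hall_right[of "h_fun \<mu>"] by (simp add: linear_iff_rat omega_add omega_scale)
    show "hall (omega (h_fun \<mu>)) (h_fun \<nu>) = hall (h_fun \<mu>) (omega (h_fun \<nu>))" for \<nu>
      by (simp add: h_fun_gen_prod omega_gen_prod hall_gen_prod_right hall_gen_prod_left
          coeff_gen_prod_commute)
  qed (rule linear_hall_right)
qed

section \<open>The creation operators\<close>

text \<open>The basis dual to the products of \<open>gen_fun q\<close>: monomial for the homogeneous
  products, forgotten for the elementary ones.\<close>

definition base_fun :: "bool \<Rightarrow> nat list \<Rightarrow> symfun" where
  "base_fun q = (if q then f_fun else m_fun)"

text \<open>The elementary case is the image of the homogeneous one under \<open>omega\<close>,
  which is self-adjoint, multiplicative and an involution: it moves from the elementary product to
  the second argument, where it turns \<open>f_fun \<mu>\<close> back into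
  \<open>m_fun \<mu>\<close>.\<close>

lemma perp_base_fun_gen_prod:
  "perp (base_fun q \<mu>) (gen_prod q \<gamma>) =
    (\<Sum>\<alpha> | \<alpha> \<subseteq># \<gamma> \<and> exponents \<alpha> = mset \<mu>. gen_prod q (\<gamma> - \<alpha>))"
proof (cases q)
  case True
  have "perp (f_fun \<mu>) (gen_prod True \<gamma>) =
      (\<Sum>\<alpha> | \<alpha> \<subseteq># \<gamma> \<and> exponents \<alpha> = mset \<mu>. gen_prod True (\<gamma> - \<alpha>))"
  proof (rule perp_eqI)
    fix v
    have "hall (gen_prod True \<gamma>) (f_fun \<mu> * v) = hall (gen_prod False \<gamma>) (m_fun \<mu> * omega v)"
      by (simp add: omega_gen_prod[symmetric] hall_omega_left omega_mult f_fun_def omega_omega)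
    then show "hall (\<Sum>\<alpha> | \<alpha> \<subseteq># \<gamma> \<and> exponents \<alpha> = mset \<mu>. gen_prod True (\<gamma> - \<alpha>)) v =
        hall (gen_prod True \<gamma>) (f_fun \<mu> * v)"
      by (simp add: hall_gen_prod_m_fun_mult hall_sum_left omega_gen_prod[symmetric] hall_omega_left)
  qed
  with True show ?thesis by (simp add: base_fun_def)
qed (simp add: base_fun_def perp_m_fun_gen_prod)

section \<open>Factoring the operators over the variables\<close>

text \<open>A submultiset of \<gamma> amounts to an independent choice of a multiplicity for each
  \<open>i\<close> in \<open>A\<close>, so the distributive law applies.\<close>

lemma sum_submultisets_prod_count:
  fixes F :: "nat \<Rightarrow> nat \<Rightarrow> 'a :: comm_semiring_1"
  assumes "finite A" "set_mset \<gamma> \<subseteq> A"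
  shows "(\<Sum>\<alpha> | \<alpha> \<subseteq># \<gamma>. \<Prod>i\<in>A. F i (count \<alpha> i)) = (\<Prod>i\<in>A. \<Sum>a\<le>count \<gamma> i. F i a)"
proof -
  have "(\<Sum>\<alpha> | \<alpha> \<subseteq># \<gamma>. \<Prod>i\<in>A. F i (count \<alpha> i)) = (\<Sum>g\<in>PiE A (\<lambda>i. {..count \<gamma> i}). \<Prod>i\<in>A. F i (g i))"
  proof (rule sum.reindex_bij_witness[where j = "\<lambda>\<alpha>. restrict (count \<alpha>) A"
        and i = "\<lambda>g. \<Sum>i\<in>A. replicate_mset (g i) i"])
    fix \<alpha> assume "\<alpha> \<in> {\<alpha>. \<alpha> \<subseteq># \<gamma>}"
    then have \<alpha>: "\<alpha> \<subseteq># \<gamma>" by simp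
    show "(\<Sum>i\<in>A. replicate_mset (restrict (count \<alpha>) A i) i) = \<alpha>"
    proof (rule multiset_eqI)
      fix j
      have "j \<notin> A \<Longrightarrow> count \<alpha> j = 0"
        using assms(2) mset_subset_eqD[OF \<alpha>, of j] by (auto simp: count_eq_zero_iff)
      then show "count (\<Sum>i\<in>A. replicate_mset (restrict (count \<alpha>) A i) i) j = count \<alpha> j"
        by (simp add: count_sum_replicate_mset[OF assms(1)])
    qed
    show "restrict (count \<alpha>) A \<in> PiE A (\<lambda>i. {..count \<gamma> i})"
      using \<alpha> by (auto simp: subseteq_mset_def)
    show "(\<Prod>i\<in>A. F i (restrict (count \<alpha>) A i)) = (\<Prod>i\<in>A. F i (count \<alpha> i))" by simp
  next
    fix g assume g: "g \<in> PiE A (\<lambda>i. {..count \<gamma> i})"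
    show "restrict (count (\<Sum>i\<in>A. replicate_mset (g i) i)) A = g"
      using g by (auto simp: fun_eq_iff restrict_def count_sum_replicate_mset[OF assms(1)] PiE_def extensional_def)
    show "(\<Sum>i\<in>A. replicate_mset (g i) i) \<in> {\<alpha>. \<alpha> \<subseteq># \<gamma>}"
      using g by (auto simp: subseteq_mset_def count_sum_replicate_mset[OF assms(1)])
  qed
  also have "\<dots> = (\<Prod>i\<in>A. \<Sum>a\<le>count \<gamma> i. F i a)"
    using assms(1) by (simp add: prod_sum_PiE)
  finally show ?thesis .
qed

text \<open>Over \<open>k\<close> variables the exponents of \<alpha>, zeros included, rearrange the
  padded list that \<open>add_ones\<close> increments. One product attached to \<open>\<mu>\<close>
  can thus be indexed to suit each \<alpha> of this shape.\<close>

lemma prod_list_gen_fun_add_ones: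
  assumes "exponents \<alpha> = mset \<mu>" "set_mset \<alpha> \<subseteq> {..<k}"
  shows "prod_list (map (gen_fun q) (add_ones k \<mu>)) = (\<Prod>i<k. gen_fun q (Suc (count \<alpha> i)))"
proof -
  have "length \<mu> = card (set_mset \<alpha>)"
    by (metis assms(1) size_exponents size_mset)
  then have "mset (map Suc (\<mu> @ replicate (k - length \<mu>) 0)) =
      image_mset Suc (image_mset (count \<alpha>) (mset_set {..<k}))"
    using image_mset_count_superset[OF _ assms(2)] assms(1) by simp
  then have "mset (map (gen_fun q) (add_ones k \<mu>)) =
      image_mset (gen_fun q) (image_mset Suc (image_mset (count \<alpha>) (mset_set {..<k})))"
    unfolding add_ones_def by (metis mset_map)
  then have "prod_list (map (gen_fun q) (add_ones k \<mu>)) =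
      prod_mset (image_mset (gen_fun q) (image_mset Suc (image_mset (count \<alpha>) (mset_set {..<k}))))"
    by (metis prod_mset_prod_list)
  then show ?thesis
    by (simp add: prod_unfold_prod_mset multiset.map_comp comp_def)
qed

text \<open>Both operators at once: \<open>q\<close> false gives \<open>CH\<close> and
  \<open>q\<close> true gives \<open>CE\<close>.\<close>

lemma sum_any_creation_gen_prod:
  fixes q :: bool and k :: nat and \<gamma> :: "nat multiset"
  assumes \<gamma>: "set_mset \<gamma> \<subseteq> {..<k}"
  defines "T \<equiv> \<lambda>\<mu>. (-1) ^ sum_list \<mu> *
    (prod_list (map (gen_fun (\<not> q)) (add_ones k \<mu>)) * perp (base_fun q \<mu>) (gen_prod q \<gamma>))"
  shows "Sum_any (\<lambda>\<mu>. if is_partition \<mu> \<and> length \<mu> \<le> k then T \<mu> else 0) =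
    (\<Prod>i<k. gen_fun q (Suc (count \<gamma> i)))"
proof -
  \<comment> \<open>A finite set containing the support: only shapes of divisors of \<gamma>
    contribute, and their size is at most \<open>size \<gamma>\<close>.\<close>
  define S where "S = {\<mu>. is_partition \<mu> \<and> length \<mu> \<le> k \<and> sum_list \<mu> \<le> size \<gamma>}"
  have fin: "finite S"
    by (rule finite_subset[OF _ finite_partitions[of "size \<gamma>"]]) (auto simp: S_def)
  \<comment> \<open>The contribution of a single \<alpha>; its sign, its incremented product and the
    product left by the adjoint all split over the variables.\<close>
  define U where "U = (\<lambda>\<alpha>. \<Prod>i<k. (-1) ^ count \<alpha> i *
    (gen_fun (\<not> q) (Suc (count \<alpha> i)) * gen_fun q (count \<gamma> i - count \<alpha> i)))"
  have T_eq: "T \<mu> = (\<Sum>\<alpha> | \<alpha> \<subseteq># \<gamma> \<and> exponents \<alpha> = mset \<mu>. U \<alpha>)" for \<mu>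
    unfolding T_def perp_base_fun_gen_prod sum_distrib_left
  proof (intro sum.cong refl)
    fix \<alpha> assume "\<alpha> \<in> {\<alpha>. \<alpha> \<subseteq># \<gamma> \<and> exponents \<alpha> = mset \<mu>}"
    then have \<alpha>: "\<alpha> \<subseteq># \<gamma>" "exponents \<alpha> = mset \<mu>" by auto
    have sub: "set_mset \<alpha> \<subseteq> {..<k}" "set_mset (\<gamma> - \<alpha>) \<subseteq> {..<k}"
      using \<gamma> \<alpha>(1) by (auto dest: mset_subset_eqD in_diffD)
    have "sum_list \<mu> = size \<alpha>"
      by (metis \<alpha>(2) sum_mset_exponents sum_mset_sum_list)
    also have "\<dots> = (\<Sum>i<k. count \<alpha> i)"
      unfolding size_multiset_overloaded_eq
      using sub(1) by (intro sum.mono_neutral_left) (auto simp: count_eq_zero_iff)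
    finally have "(-1 :: symfun) ^ sum_list \<mu> = (\<Prod>i<k. (-1) ^ count \<alpha> i)"
      by (simp add: power_sum)
    then show "(-1) ^ sum_list \<mu> * (prod_list (map (gen_fun (\<not> q)) (add_ones k \<mu>)) * gen_prod q (\<gamma> - \<alpha>)) = U \<alpha>"
      using \<alpha>(2) sub by (simp add: U_def prod_list_gen_fun_add_ones gen_prod_superset[of "{..<k}"] prod.distrib)
  qed
  have "Sum_any (\<lambda>\<mu>. if is_partition \<mu> \<and> length \<mu> \<le> k then T \<mu> else 0) =
      (\<Sum>\<mu>\<in>S. if is_partition \<mu> \<and> length \<mu> \<le> k then T \<mu> else 0)"
  proof (rule Sum_any.expand_superset[OF fin], rule subsetI)
    fix \<mu> assume "\<mu> \<in> {\<mu>. (if is_partition \<mu> \<and> length \<mu> \<le> k then T \<mu> else 0) \<noteq> 0}"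
    then have \<mu>: "is_partition \<mu>" "length \<mu> \<le> k" "T \<mu> \<noteq> 0" by (auto split: if_splits)
    from \<mu>(3) have "{\<alpha>. \<alpha> \<subseteq># \<gamma> \<and> exponents \<alpha> = mset \<mu>} \<noteq> {}"
      unfolding T_eq by (metis sum.empty)
    then obtain \<alpha> where "\<alpha> \<subseteq># \<gamma>" "exponents \<alpha> = mset \<mu>" by auto
    then have "sum_list \<mu> \<le> size \<gamma>"
      by (metis size_mset_mono sum_mset_exponents sum_mset_sum_list)
    with \<mu> show "\<mu> \<in> S" by (simp add: S_def)
  qed
  \<comment> \<open>The inner sums run over the fibres of the map sending a divisor of \<gamma> to
    its sorted shape.\<close>
  also have "\<dots> = (\<Sum>\<mu>\<in>S. \<Sum>\<alpha> | \<alpha> \<in> {\<alpha>. \<alpha> \<subseteq># \<gamma>} \<and> sort_partition (exponents \<alpha>) = \<mu>. U \<alpha>)"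
  proof (rule sum.cong)
    fix \<mu> assume \<mu>: "\<mu> \<in> S"
    have "sort_partition (exponents \<alpha>) = \<mu> \<longleftrightarrow> exponents \<alpha> = mset \<mu>" for \<alpha>
      using \<mu> is_partition_mset_inject[OF is_partition_sort_partition[OF zero_notin_exponents]]
      by (auto simp: S_def)
    with \<mu> show "(if is_partition \<mu> \<and> length \<mu> \<le> k then T \<mu> else 0) =
        (\<Sum>\<alpha> | \<alpha> \<in> {\<alpha>. \<alpha> \<subseteq># \<gamma>} \<and> sort_partition (exponents \<alpha>) = \<mu>. U \<alpha>)"
      by (simp add: S_def T_eq)
  qed simp
  \<comment> \<open>The fibres exhaust all divisors: each uses at most \<open>k\<close> variables
    because \<gamma> does, so its shape lies in \<open>S\<close>.\<close>
  also have "\<dots> = (\<Sum>\<alpha> | \<alpha> \<subseteq># \<gamma>. U \<alpha>)"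
  proof (rule sum.group[OF finite_submultisets fin], rule image_subsetI)
    fix \<alpha> assume "\<alpha> \<in> {\<alpha>. \<alpha> \<subseteq># \<gamma>}"
    then have \<alpha>: "\<alpha> \<subseteq># \<gamma>" by simp
    then have "set_mset \<alpha> \<subseteq> {..<k}" using \<gamma> by (auto dest: mset_subset_eqD)
    then have "card (set_mset \<alpha>) \<le> k" by (metis card_lessThan card_mono finite_lessThan)
    then have "length (sort_partition (exponents \<alpha>)) \<le> k"
      by (metis mset_sort_partition size_exponents size_mset)
    moreover have "sum_list (sort_partition (exponents \<alpha>)) \<le> size \<gamma>"
      using size_mset_mono[OF \<alpha>] by (metis mset_sort_partition sum_mset_exponents sum_mset_sum_list)
    ultimately show "sort_partition (exponents \<alpha>) \<in> S"
      by (simp add: S_def is_partition_sort_partition zero_notin_exponents)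
  qed
  also have "\<dots> = (\<Prod>i<k. \<Sum>a\<le>count \<gamma> i. (-1) ^ a *
      (gen_fun (\<not> q) (Suc a) * gen_fun q (count \<gamma> i - a)))"
    unfolding U_def by (rule sum_submultisets_prod_count) (use \<gamma> in auto)
  also have "\<dots> = (\<Prod>i<k. gen_fun q (Suc (count \<gamma> i)))"
    by (simp add: gen_fun_Suc_eq_sum)
  finally show ?thesis .
qed

theorem mainTheorem2:
  fixes k :: nat and \<mu> :: "nat list"
  assumes "is_partition \<mu>" and "length \<mu> \<le> k"
  shows "CH k (h_fun \<mu>) = h_fun (add_ones k \<mu>) \<and> CE k (e_fun \<mu>) = e_fun (add_ones k \<mu>)"
proof -
  have sub: "set_mset (monom_mset \<mu>) \<subseteq> {..<k}"
    using set_mset_monom_mset[of \<mu>] assms(2) by auto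
  \<comment> \<open>Here \<alpha> is the monomial of \<open>\<mu>\<close> itself, which identifies
    the target product with the value of the creation operator.\<close>
  have prod: "prod_list (map (gen_fun q) (add_ones k \<mu>)) = (\<Prod>i<k. gen_fun q (Suc (count (monom_mset \<mu>) i)))" for q
    using exponents_monom_mset_partition[OF assms(1)] sub by (rule prod_list_gen_fun_add_ones)
  have "CH k (h_fun \<mu>) = h_fun (add_ones k \<mu>)"
    using sum_any_creation_gen_prod[OF sub, of False] prod[of False]
    by (simp add: CH_def h_fun_gen_prod[of \<mu>] h_fun_def[of "add_ones k \<mu>"] e_fun_def gen_fun_def base_fun_def
        cong: if_cong)
  moreover have "CE k (e_fun \<mu>) = e_fun (add_ones k \<mu>)"
    using sum_any_creation_gen_prod[OF sub, of True] prod[of True]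
    by (simp add: CE_def e_fun_gen_prod[of \<mu>] e_fun_def[of "add_ones k \<mu>"] h_fun_def gen_fun_def base_fun_def
        cong: if_cong)
  ultimately show ?thesis ..
qed

end
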